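(* For each $n\in\mathbb{N}$, the map $\widetilde{T}$ is a homeomorphism of $\widetilde{\mathcal{K}}_n$; in the DC case $\widetilde{\varphi}^t$ is a continuous flow on $\widetilde{\mathcal{K}}_n$; in the AC case $\widetilde{\varphi}^1$ is a homeomorphism of $\widetilde{\mathcal{K}}_n$; and $\widetilde{T}$ commutes with $\widetilde{\varphi}^t$ for all $t$ (DC case), respectively with $\widetilde{\varphi}^1$ (AC case).
   Context: Setting. $V:\mathbb{R}^2\to\mathbb{R}$ is $C^2$, satisfies $V(u+1,v+1)=V(u,v)$ and the twist condition $V_{12}(u,v)\le-\delta<0$ for some fixed $\delta$ (subscripts denote partial derivatives). $F$ is either constant (the DC case) or a $1$-periodic function of $t$ (the AC case); in the AC case $V$ and $F$ are in addition real analytic. The system is $$\frac{d}{dt}u_j(t)=-V_2(u_{j-1}(t),u_j(t))-V_1(u_j(t),u_{j+1}(t))+F(t),\qquad j\in\mathbb{Z}.$$ State space. $K_n=\{u\in\mathbb{R}^{\mathbb{Z}}:\sup_i|u_{i+1}-u_i|\le n\}$, $X=\bigcup_{n\ge1}K_n$, with the induced product topology. $\mathcal{X}=X/R$ and $\mathcal{K}_n=K_n/R$ are the quotients obtained by identifying $u$ with $Ru=u+1$. $T$ is the shift $(Tu)_i=u_{i-1}$. For $u\in X$, $\varphi^t(u)=u(t)$ denotes the solution with $u(0)=u$; it exists for all $t\ge0$, leaves each $\mathcal{K}_n$ forward invariant, is continuous on $\mathcal{K}_n$, and commutes with $R$ and $T$. Invariant measures. A Borel probability measure is $(\varphi,T)$-invariant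 if it is invariant under $T$ and under all $\varphi^t$, $t\ge0$ (DC case), respectively under $T$ and $\varphi^1$ (AC case). $\mathcal{E}(\mathcal{K}_n)$ is the set of $(\varphi,T)$-invariant Borel probability measures on $\mathcal{K}_n$, and $\mathcal{A}_n=\bigcup_{\mu\in\mathcal{E}(\mathcal{K}_n)}\mathrm{supp}(\mu)$. The projection $\pi(u)=(u_0\bmod 1,\;u_1-u_0)\in\mathbb{T}^1\times\mathbb{R}$ is continuous, and it is injective on $\bigcup_n\mathcal{A}_n$. Put $\widetilde{\mathcal{K}}_n=\pi(\mathcal{A}_n)$ and, with $\pi^{-1}:\widetilde{\mathcal{K}}_n\to\mathcal{A}_n$ the inverse of $\pi|_{\mathcal{A}_n}$, $\widetilde{T}=\pi\circ T\circ\pi^{-1}$ and $\widetilde{\varphi}^t=\pi\circ\varphi^t\circ\pi^{-1}$. (That $\widetilde{\varphi}^t$ is a flow means in particular that it is defined for all $t\in\mathbb{R}$, i.e. $\varphi^t$ is invertible on $\mathcal{A}_n$.) *)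

theory Defs
  imports "HOL-Analysis.Analysis" "HOL-Probability.Probability_Measure"
begin

section \<open>The potential and the driving force\<close>

definition D1 :: "(real \<Rightarrow> real \<Rightarrow> real) \<Rightarrow> real \<Rightarrow> real \<Rightarrow> real" where
  "D1 f u v = deriv (\<lambda>x. f x v) u"

definition D2 :: "(real \<Rightarrow> real \<Rightarrow> real) \<Rightarrow> real \<Rightarrow> real \<Rightarrow> real" where
  "D2 f u v = deriv (\<lambda>y. f u y) v"

definition C1_plane :: "(real \<Rightarrow> real \<Rightarrow> real) \<Rightarrow> bool" where
  "C1_plane f \<longleftrightarrow>
     (\<forall>u v. (\<lambda>x. f x v) field_differentiable at u \<and> (\<lambda>y. f u y) field_differentiable at v) \<and>
     continuous_on UNIV (\<lambda>(u, v). D1 f u v) \<and>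
     continuous_on UNIV (\<lambda>(u, v). D2 f u v)"

definition C2_plane :: "(real \<Rightarrow> real \<Rightarrow> real) \<Rightarrow> bool" where
  "C2_plane f \<longleftrightarrow> C1_plane f \<and> C1_plane (D1 f) \<and> C1_plane (D2 f)"

definition real_analytic :: "(real \<Rightarrow> real) \<Rightarrow> bool" where
  "real_analytic f \<longleftrightarrow>
     (\<forall>a. \<exists>c :: nat \<Rightarrow> real. \<exists>r>0. \<forall>x. \<bar>x - a\<bar> < r \<longrightarrow> (\<lambda>i. c i * (x - a) ^ i) sums f x)"

definition real_analytic_plane :: "(real \<Rightarrow> real \<Rightarrow> real) \<Rightarrow> bool" where
  "real_analytic_plane f \<longleftrightarrow>
     (\<forall>a b. \<exists>c :: nat \<Rightarrow> nat \<Rightarrow> real. \<exists>r>0. \<forall>x y. \<bar>x - a\<bar> < r \<and> \<bar>y - b\<bar> < r \<longrightarrow>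
        ((\<lambda>(i, j). c i j * (x - a) ^ i * (y - b) ^ j) has_sum f x y) UNIV)"

definition twist_potential :: "(real \<Rightarrow> real \<Rightarrow> real) \<Rightarrow> bool" where
  "twist_potential V \<longleftrightarrow>
     C2_plane V \<and> (\<forall>u v. V (u + 1) (v + 1) = V u v) \<and>
     (\<exists>\<delta>>0. \<forall>u v. D2 (D1 V) u v \<le> - \<delta>)"

datatype driving = DC | AC

fun admissible_driving :: "driving \<Rightarrow> (real \<Rightarrow> real \<Rightarrow> real) \<Rightarrow> (real \<Rightarrow> real) \<Rightarrow> bool" where
  "admissible_driving DC V F \<longleftrightarrow> (\<exists>c. \<forall>t. F t = c)"
| "admissible_driving AC V F \<longleftrightarrow>
     (\<forall>t. F (t + 1) = F t) \<and> real_analytic F \<and> real_analytic_plane V"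

section \<open>State space and solutions\<close>

text \<open>Sets of configurations carry the topology of \<^typ>\<open>int \<Rightarrow> real\<close>, which is the product
  topology.\<close>

definition K :: "nat \<Rightarrow> (int \<Rightarrow> real) set" where
  "K n = {u. \<forall>i. \<bar>u (i + 1) - u i\<bar> \<le> real n}"

definition X :: "(int \<Rightarrow> real) set" where
  "X = (\<Union>n\<in>{1..}. K n)"

definition shift :: "(int \<Rightarrow> real) \<Rightarrow> int \<Rightarrow> real" where
  "shift u = (\<lambda>i. u (i - 1))"

text \<open>\<open>\<phi> t u\<close> is the state at time \<open>t \<ge> 0\<close> of the solution starting at \<open>u\<close> at time 0; its values
  for \<open>t < 0\<close> or \<open>u \<notin> X\<close> are irrelevant. Solutions are taken in the class of curves that stay in
  every \<open>K n\<close> containing the initial condition; in this class they exist and are unique, so the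
  conditions below determine \<open>\<phi> t u\<close> for \<open>t \<ge> 0\<close> and \<open>u \<in> X\<close>.\<close>

definition solution_semiflow ::
  "(real \<Rightarrow> real \<Rightarrow> real) \<Rightarrow> (real \<Rightarrow> real) \<Rightarrow> (real \<Rightarrow> (int \<Rightarrow> real) \<Rightarrow> int \<Rightarrow> real) \<Rightarrow> bool" where
  "solution_semiflow V F \<phi> \<longleftrightarrow>
     (\<forall>u\<in>X. \<phi> 0 u = u \<and>
        (\<forall>t\<ge>0. \<forall>j. ((\<lambda>s. \<phi> s u j) has_real_derivative
           (- D2 V (\<phi> t u (j - 1)) (\<phi> t u j) - D1 V (\<phi> t u j) (\<phi> t u (j + 1)) + F t))
           (at t within {0..})) \<and>
        (\<forall>n. u \<in> K n \<longrightarrow> (\<forall>t\<ge>0. \<phi> t u \<in> K n)))"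

section \<open>Quotient spaces\<close>

definition quotient_topology :: "'a topology \<Rightarrow> ('a \<Rightarrow> 'b) \<Rightarrow> 'b topology" where
  "quotient_topology S q =
     topology (\<lambda>U. U \<subseteq> q ` topspace S \<and> openin S {x \<in> topspace S. q x \<in> U})"

lemma openin_quotient_topology:
  fixes q :: "'a \<Rightarrow> 'b"
  shows "openin (quotient_topology S q) U \<longleftrightarrow>
     U \<subseteq> q ` topspace S \<and> openin S {x \<in> topspace S. q x \<in> U}"
proof -
  have "istopology (\<lambda>U. U \<subseteq> q ` topspace S \<and> openin S {x \<in> topspace S. q x \<in> U})"
    unfolding istopology_def
  proof (intro conjI allI impI)
    fix A B
    assume A: "A \<subseteq> q ` topspace S \<and> openin S {x \<in> topspace S. q x \<in> A}"
      and B: "B \<subseteq> q ` topspace S \<and> openin S {x \<in> topspace S. q x \<in> B}"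
    show "A \<inter> B \<subseteq> q ` topspace S" using A by blast
    have "{x \<in> topspace S. q x \<in> A \<inter> B} =
      {x \<in> topspace S. q x \<in> A} \<inter> {x \<in> topspace S. q x \<in> B}" by blast
    then show "openin S {x \<in> topspace S. q x \<in> A \<inter> B}" using A B by auto
  next
    fix \<A> :: "'b set set"
    assume *: "\<forall>A\<in>\<A>. A \<subseteq> q ` topspace S \<and> openin S {x \<in> topspace S. q x \<in> A}"
    show "\<Union>\<A> \<subseteq> q ` topspace S" using * by blast
    have "{x \<in> topspace S. q x \<in> \<Union>\<A>} = (\<Union>A\<in>\<A>. {x \<in> topspace S. q x \<in> A})" by blast
    then show "openin S {x \<in> topspace S. q x \<in> \<Union>\<A>}" using * by auto
  qed
  then show ?thesis
    unfolding quotient_topology_def by (simp add: topology_inverse')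
qed

lemma topspace_quotient_topology [simp]:
  "topspace (quotient_topology S q) = q ` topspace S"
proof -
  have "{x \<in> topspace S. q x \<in> q ` topspace S} = topspace S" by auto
  then have "openin (quotient_topology S q) (q ` topspace S)"
    by (simp add: openin_quotient_topology)
  then show ?thesis
    by (metis openin_quotient_topology openin_subset openin_topspace subset_antisym)
qed

lemma quotient_map_quotient_topology: "quotient_map S (quotient_topology S q) q"
  unfolding quotient_map_def by (auto simp: openin_quotient_topology)

text \<open>The class of \<open>u\<close> modulo \<open>u \<sim> u + 1\<close>, represented as the set of all \<open>u + k\<close> with \<open>k\<close> an
  integer; likewise for real numbers.\<close>

definition config_class :: "(int \<Rightarrow> real) \<Rightarrow> (int \<Rightarrow> real) set" where
  "config_class u = {(\<lambda>i. u i + of_int k) | k :: int. True}"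

definition real_class :: "real \<Rightarrow> real set" where
  "real_class x = {x + of_int k | k :: int. True}"

definition KQ :: "nat \<Rightarrow> (int \<Rightarrow> real) set topology" where
  "KQ n = quotient_topology (top_of_set (K n)) config_class"

definition circle :: "real set topology" where
  "circle = quotient_topology euclideanreal real_class"

section \<open>Invariant measures\<close>

definition borel_sigma :: "'a topology \<Rightarrow> 'a measure" where
  "borel_sigma S = sigma (topspace S) {U. openin S U}"

definition supp :: "'a topology \<Rightarrow> 'a measure \<Rightarrow> 'a set" where
  "supp S \<mu> = {x \<in> topspace S. \<forall>U. openin S U \<and> x \<in> U \<longrightarrow> emeasure \<mu> U > 0}"

definition preserved_by :: "'a measure \<Rightarrow> ('a \<Rightarrow> 'a) \<Rightarrow> bool" where
  "preserved_by \<mu> f \<longleftrightarrow> f \<in> measurable \<mu> \<mu> \<and> distr \<mu> \<mu> f = \<mu>"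

text \<open>A map \<open>f\<close> of configurations that commutes with \<open>u \<mapsto> u + 1\<close>, such as the shift or \<open>\<phi> t\<close> on
  \<open>X\<close>, sends the class of \<open>u\<close> onto the class of \<open>f u\<close>. The map it induces on classes is
  therefore the direct image \<open>(`) f\<close>.\<close>

fun times :: "driving \<Rightarrow> real set" where
  "times DC = {0..}"
| "times AC = {1}"

definition invariant_measures ::
  "driving \<Rightarrow> (real \<Rightarrow> (int \<Rightarrow> real) \<Rightarrow> int \<Rightarrow> real) \<Rightarrow> nat \<Rightarrow> (int \<Rightarrow> real) set measure set" where
  "invariant_measures d \<phi> n =
     {\<mu>. prob_space \<mu> \<and> space \<mu> = topspace (KQ n) \<and> sets \<mu> = sets (borel_sigma (KQ n)) \<and>
         preserved_by \<mu> ((`) shift) \<and> (\<forall>t\<in>times d. preserved_by \<mu> ((`) (\<phi> t)))}"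

definition attractor ::
  "driving \<Rightarrow> (real \<Rightarrow> (int \<Rightarrow> real) \<Rightarrow> int \<Rightarrow> real) \<Rightarrow> nat \<Rightarrow> (int \<Rightarrow> real) set set" where
  "attractor d \<phi> n = (\<Union>\<mu>\<in>invariant_measures d \<phi> n. supp (KQ n) \<mu>)"

section \<open>The projected dynamics on the cylinder\<close>

text \<open>On the class of \<open>u\<close> the first component is the class of \<open>u 0\<close>, and the second is the common
  value of \<open>w 1 - w 0\<close> over all representatives \<open>w\<close>.\<close>

definition proj :: "(int \<Rightarrow> real) set \<Rightarrow> real set \<times> real" where
  "proj C = ((\<lambda>w. w 0) ` C, the_elem ((\<lambda>w. w 1 - w 0) ` C))"

lemma proj_config_class: "proj (config_class u) = (real_class (u 0), u 1 - u 0)"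
proof -
  have "(\<lambda>w. w 0) ` config_class u = real_class (u 0)"
    unfolding config_class_def real_class_def by auto
  moreover have "(\<lambda>w. w 1 - w 0) ` config_class u = {u 1 - u 0}"
    unfolding config_class_def by (auto intro!: image_eqI[where x = u] exI[where x = 0])
  ultimately show ?thesis unfolding proj_def by simp
qed

definition proj_inv ::
  "driving \<Rightarrow> (real \<Rightarrow> (int \<Rightarrow> real) \<Rightarrow> int \<Rightarrow> real) \<Rightarrow> nat \<Rightarrow> real set \<times> real \<Rightarrow> (int \<Rightarrow> real) set" where
  "proj_inv d \<phi> n = inv_into (attractor d \<phi> n) proj"

definition K_tilde ::
  "driving \<Rightarrow> (real \<Rightarrow> (int \<Rightarrow> real) \<Rightarrow> int \<Rightarrow> real) \<Rightarrow> nat \<Rightarrow> (real set \<times> real) topology" where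
  "K_tilde d \<phi> n = subtopology (prod_topology circle euclideanreal) (proj ` attractor d \<phi> n)"

definition T_tilde ::
  "driving \<Rightarrow> (real \<Rightarrow> (int \<Rightarrow> real) \<Rightarrow> int \<Rightarrow> real) \<Rightarrow> nat \<Rightarrow> real set \<times> real \<Rightarrow> real set \<times> real" where
  "T_tilde d \<phi> n = proj \<circ> (`) shift \<circ> proj_inv d \<phi> n"

text \<open>For \<open>t < 0\<close>, \<open>\<phi>\<^sup>t\<close> means the inverse of the restriction of \<open>\<phi>\<^sup>-\<^sup>t\<close> to the attractor.\<close>

definition phi_attractor ::
  "driving \<Rightarrow> (real \<Rightarrow> (int \<Rightarrow> real) \<Rightarrow> int \<Rightarrow> real) \<Rightarrow> nat \<Rightarrow> real \<Rightarrow>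
     (int \<Rightarrow> real) set \<Rightarrow> (int \<Rightarrow> real) set" where
  "phi_attractor d \<phi> n t =
     (if 0 \<le> t then (`) (\<phi> t) else inv_into (attractor d \<phi> n) ((`) (\<phi> (- t))))"

definition phi_tilde ::
  "driving \<Rightarrow> (real \<Rightarrow> (int \<Rightarrow> real) \<Rightarrow> int \<Rightarrow> real) \<Rightarrow> nat \<Rightarrow> real \<Rightarrow>
     real set \<times> real \<Rightarrow> real set \<times> real" where
  "phi_tilde d \<phi> n t = proj \<circ> phi_attractor d \<phi> n t \<circ> proj_inv d \<phi> n"

definition continuous_flow :: "'a topology \<Rightarrow> (real \<Rightarrow> 'a \<Rightarrow> 'a) \<Rightarrow> bool" where
  "continuous_flow S \<Phi> \<longleftrightarrow>
     continuous_map (prod_topology euclideanreal S) S (\<lambda>(t, x). \<Phi> t x) \<and>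
     (\<forall>x\<in>topspace S. \<Phi> 0 x = x) \<and>
     (\<forall>s t. \<forall>x\<in>topspace S. \<Phi> (s + t) x = \<Phi> s (\<Phi> t x))"

end

theory Submission
  imports Defs "HOL-Probability.Probability_Mass_Function" "HOL-Real_Asymp.Real_Asymp"
begin

text \<open>The lattice equation is a Lipschitz ordinary differential equation for the norm
  \<open>sup \<bar>w\<^sub>j\<bar> / 2\<^bsup>\<bar>j\<bar>\<^esup>\<close> on differences of configurations in \<open>K n\<close>. A Gronwall estimate, valid in both
  directions of time, makes \<open>\<phi>\<^sup>t\<close> continuous and injective on the compact Hausdorff quotient of
  \<open>K n\<close>. A continuous self-map of a compact space maps the support of an invariant measure onto
  itself, so the shift and \<open>\<phi>\<^sup>t\<close> permute the attractor. The attractor is the support of a single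
  invariant measure, namely a countable mixture, hence compact; therefore the projection is a
  homeomorphism onto its image and transports the dynamics.\<close>

section \<open>Supports of invariant measures\<close>

text \<open>Two facts dictate the weight. Configurations in \<open>K n\<close> may drift apart
  linearly, so the unweighted supremum of their difference can be infinite; and the equation at a
  site reads only its neighbours, so a weight with bounded ratio between adjacent sites keeps the
  Lipschitz constant finite. The constant itself exists because neighbouring values always lie in
  the strip \<open>\<bar>v - u\<bar> \<le> n\<close>, which is compact modulo the diagonal period of
  \<open>V\<close>. The obstacle is invertibility: nothing provides a configuration in
  \<open>K n\<close> with a past inside \<open>K n\<close>, so the semiflow is injective but may
  fail to be onto. Invariant measures supply the preimages, and only on supports. A union of
  supports over all measures has no general reason to be closed, while compactness is what upgrades
  a continuous injection to a homeomorphism; this is why the union is rewritten as one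
  support.\<close>

lemma space_borel_sigma [simp]: "space (borel_sigma S) = topspace S"
  by (simp add: borel_sigma_def space_measure_of_conv)

lemma openin_imp_borel_sigma: "openin S U \<Longrightarrow> U \<in> sets (borel_sigma S)"
  unfolding borel_sigma_def using openin_subset by (subst sets_measure_of) auto

lemma closedin_supp: "closedin S (supp S \<mu>)"
proof -
  have "topspace S - supp S \<mu> = \<Union>{U. openin S U \<and> emeasure \<mu> U = 0}"
    unfolding supp_def using openin_subset by (auto simp: not_gr_zero)
  then have "openin S (topspace S - supp S \<mu>)" by (auto intro: openin_Union)
  then show ?thesis by (simp add: closedin_def supp_def)
qed

text \<open>The complement of the support is a union of open null sets, in general an uncountable
  one; the null members of a countable base already cover it.\<close>

lemma null_sets_supp:
  assumes "second_countable S" and sets: "sets \<mu> = sets (borel_sigma S)"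
  shows "topspace S - supp S \<mu> \<in> null_sets \<mu>"
proof -
  obtain \<B> where \<B>: "countable \<B>" "\<And>V. V \<in> \<B> \<Longrightarrow> openin S V"
    and base: "\<And>U x. openin S U \<and> x \<in> U \<longrightarrow> (\<exists>V\<in>\<B>. x \<in> V \<and> V \<subseteq> U)"
    using assms(1) by (auto simp: second_countable_def)
  define \<N> where "\<N> = {V \<in> \<B>. V \<in> null_sets \<mu>}"
  have "topspace S - supp S \<mu> = (\<Union>V\<in>\<N>. V)"
  proof (intro equalityI subsetI)
    fix x assume "x \<in> topspace S - supp S \<mu>"
    then obtain U where U: "openin S U" "x \<in> U" "emeasure \<mu> U = 0"
      unfolding supp_def by (auto simp: not_gr_zero)
    then obtain V where V: "V \<in> \<B>" "x \<in> V" "V \<subseteq> U" using base by blast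
    have "U \<in> null_sets \<mu>" using U openin_imp_borel_sigma sets by (auto simp: null_sets_def)
    moreover have "V \<in> sets \<mu>" using \<B>(2)[OF V(1)] openin_imp_borel_sigma sets by auto
    ultimately have "V \<in> null_sets \<mu>" using V(3) null_sets_subset by blast
    then show "x \<in> (\<Union>V\<in>\<N>. V)" using V by (auto simp: \<N>_def)
  next
    fix x assume "x \<in> (\<Union>V\<in>\<N>. V)"
    then show "x \<in> topspace S - supp S \<mu>"
      unfolding \<N>_def supp_def null_sets_def using \<B>(2) openin_subset by fastforce
  qed
  also have "\<dots> \<in> null_sets \<mu>"
    using \<B>(1) by (intro null_sets_UN') (auto simp: \<N>_def)
  finally show ?thesis .
qed

text \<open>Preimages of neighbourhoods of \<open>f x\<close> are neighbourhoods of \<open>x\<close>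
  of the same measure, which gives one inclusion. For the other, the image of the support is
  compact, hence closed; the preimage of its complement misses the support, so by invariance that
  complement is an open null set and contains no support point.\<close>

lemma image_supp:
  assumes "compact_space S" "Hausdorff_space S" "second_countable S"
    and f: "continuous_map S S f"
    and sets: "sets \<mu> = sets (borel_sigma S)" and pres: "preserved_by \<mu> f"
  shows "f ` supp S \<mu> = supp S \<mu>"
proof
  have space: "space \<mu> = topspace S" using sets_eq_imp_space_eq[OF sets] by simp
  have emeasure_vimage: "emeasure \<mu> {x \<in> topspace S. f x \<in> U} = emeasure \<mu> U" if "openin S U" for U
  proof -
    have "U \<in> sets \<mu>" using that openin_imp_borel_sigma sets by auto
    moreover have "f \<in> measurable \<mu> \<mu>" "distr \<mu> \<mu> f = \<mu>" using pres by (auto simp: preserved_by_def)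
    ultimately have "emeasure \<mu> U = emeasure \<mu> (f -` U \<inter> space \<mu>)" by (metis emeasure_distr)
    also have "f -` U \<inter> space \<mu> = {x \<in> topspace S. f x \<in> U}" by (auto simp: space)
    finally show ?thesis by simp
  qed
  show "f ` supp S \<mu> \<subseteq> supp S \<mu>"
  proof (rule image_subsetI)
    fix x assume x: "x \<in> supp S \<mu>"
    then have "x \<in> topspace S" by (simp add: supp_def)
    show "f x \<in> supp S \<mu>"
      unfolding supp_def
    proof (intro CollectI conjI allI impI; (elim conjE)?)
      show "f x \<in> topspace S"
        using f \<open>x \<in> topspace S\<close> continuous_map_image_subset_topspace by fastforce
      fix U assume U: "openin S U" "f x \<in> U"
      have "openin S {x \<in> topspace S. f x \<in> U}" using f U(1) by (rule openin_continuous_map_preimage)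
      then have "emeasure \<mu> {x \<in> topspace S. f x \<in> U} > 0"
        using x U(2) \<open>x \<in> topspace S\<close> unfolding supp_def by blast
      then show "emeasure \<mu> U > 0" by (simp add: emeasure_vimage[OF U(1)])
    qed
  qed
  show "supp S \<mu> \<subseteq> f ` supp S \<mu>"
  proof
    fix y assume y: "y \<in> supp S \<mu>"
    show "y \<in> f ` supp S \<mu>"
    proof (rule ccontr)
      assume "y \<notin> f ` supp S \<mu>"
      define U where "U = topspace S - f ` supp S \<mu>"
      have "compactin S (f ` supp S \<mu>)"
        using assms(1) closedin_supp f by (intro image_compactin[of S]) (auto intro: closedin_compact_space)
      then have U: "openin S U"
        unfolding U_def using assms(2) by (intro openin_diff compactin_imp_closedin) auto
      have "y \<in> U" using y \<open>y \<notin> _\<close> by (auto simp: U_def supp_def)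
      then have "emeasure \<mu> U > 0" using y U by (auto simp: supp_def)
      then have "emeasure \<mu> {x \<in> topspace S. f x \<in> U} > 0" by (simp add: emeasure_vimage[OF U])
      moreover have "emeasure \<mu> {x \<in> topspace S. f x \<in> U} \<le> emeasure \<mu> (topspace S - supp S \<mu>)"
        using null_sets_supp[OF assms(3) sets]
        by (intro emeasure_mono) (auto simp: U_def null_sets_def)
      moreover have "emeasure \<mu> (topspace S - supp S \<mu>) = 0"
        using null_sets_supp[OF assms(3) sets] by (rule null_setsD1)
      ultimately show False by simp
    qed
  qed
qed

section \<open>Mixtures of invariant measures\<close>

lemma countable_mixture:
  fixes M :: "nat \<Rightarrow> 'a measure"
  assumes prob: "\<And>k. prob_space (M k)" and sets: "\<And>k. sets (M k) = sets N"
  obtains \<nu> where "prob_space \<nu>" "sets \<nu> = sets N"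
    "\<And>f. (\<And>k. preserved_by (M k) f) \<Longrightarrow> preserved_by \<nu> f"
    "\<And>k A. A \<in> sets N \<Longrightarrow> emeasure (M k) A > 0 \<Longrightarrow> emeasure \<nu> A > 0"
proof
  \<comment> \<open>Any law on the naturals that charges every index would serve: a set charged by
    one \<open>M k\<close> is then charged by the mixture.\<close>
  define p where "p = geometric_pmf (1 / 2)"
  define \<nu> where "\<nu> = measure_pmf p \<bind> M"
  have M: "M \<in> measurable (measure_pmf p) (subprob_algebra N)"
    using prob sets by (auto simp: space_subprob_algebra prob_space_imp_subprob_space)
  have em: "emeasure \<nu> A = (\<integral>\<^sup>+k. emeasure (M k) A \<partial>measure_pmf p)" if "A \<in> sets N" for A
    unfolding \<nu>_def using that by (intro emeasure_bind[OF _ M]) auto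
  show sets_\<nu>: "sets \<nu> = sets N" unfolding \<nu>_def using sets by (intro sets_bind) auto
  then have space_\<nu>: "space \<nu> = space N" by (rule sets_eq_imp_space_eq)
  have space_M: "space (M k) = space N" for k using sets by (rule sets_eq_imp_space_eq)
  show "prob_space \<nu>"
  proof (rule prob_spaceI)
    have "emeasure (M k) (space N) = 1" for k
      using prob_space.emeasure_space_1[OF prob[of k]] by (simp add: space_M)
    then show "emeasure \<nu> (space \<nu>) = 1"
      by (simp add: space_\<nu> em measure_pmf.emeasure_space_1)
  qed
  show "preserved_by \<nu> f" if f: "\<And>k. preserved_by (M k) f" for f
  proof -
    have meas: "f \<in> measurable N N"
      using f[of 0] unfolding preserved_by_def by (simp add: measurable_cong_sets[OF sets sets])
    then have meas_\<nu>: "f \<in> measurable \<nu> \<nu>" by (simp add: measurable_cong_sets[OF sets_\<nu> sets_\<nu>])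
    have "distr \<nu> \<nu> f = \<nu>"
    proof (rule measure_eqI)
      fix A assume "A \<in> sets (distr \<nu> \<nu> f)"
      then have A: "A \<in> sets N" by (simp add: sets_\<nu>)
      have pre: "f -` A \<inter> space N \<in> sets N" using meas A by (rule measurable_sets)
      have "emeasure (M k) (f -` A \<inter> space N) = emeasure (M k) A" for k
        using f[of k] emeasure_distr[of f "M k" "M k" A] A
        by (simp add: preserved_by_def sets space_M)
      then show "emeasure (distr \<nu> \<nu> f) A = emeasure \<nu> A"
        using meas_\<nu> A pre by (simp add: emeasure_distr sets_\<nu> space_\<nu> em)
    qed simp
    with meas_\<nu> show ?thesis by (simp add: preserved_by_def)
  qed
  show "emeasure \<nu> A > 0" if A: "A \<in> sets N" and pos: "emeasure (M k) A > 0" for k A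
  proof (rule ccontr)
    assume "\<not> emeasure \<nu> A > 0"
    then have "AE k in measure_pmf p. emeasure (M k) A = 0"
      using A by (simp add: em not_gr_zero nn_integral_0_iff_AE)
    then show False using pos by (auto simp: AE_measure_pmf_iff p_def set_pmf_geometric)
  qed
qed

lemma invariant_measures_sets:
  "\<mu> \<in> invariant_measures d \<phi> n \<Longrightarrow> sets \<mu> = sets (borel_sigma (KQ n))"
  by (simp add: invariant_measures_def)

lemma attractor_subset: "attractor d \<phi> n \<subseteq> topspace (KQ n)"
  by (auto simp: attractor_def supp_def)

text \<open>A mixture of measures whose supports meet a countable dense subset of the attractor is
  itself invariant, and its support is the whole attractor.\<close>

lemma attractor_eq_supp:
  assumes sc: "second_countable (KQ n)" and ne: "attractor d \<phi> n \<noteq> {}"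
  obtains \<mu> where "\<mu> \<in> invariant_measures d \<phi> n" "attractor d \<phi> n = supp (KQ n) \<mu>"
proof -
  define A where "A = attractor d \<phi> n"
  have A_sub: "A \<subseteq> topspace (KQ n)" unfolding A_def by (rule attractor_subset)
  obtain C where C: "countable C" "C \<subseteq> A" "subtopology (KQ n) A closure_of C = A"
  proof -
    have "separable_space (subtopology (KQ n) A)"
      by (intro second_countable_imp_separable_space second_countable_subtopology sc)
    then show thesis using that A_sub by (auto simp: separable_space_def inf_absorb2)
  qed
  \<comment> \<open>\<open>from_nat_into\<close> lists \<open>C\<close> with repetitions, so finite
    and infinite \<open>C\<close> are treated alike once \<open>C\<close> is nonempty.\<close>
  have "C \<noteq> {}" using C(3) ne by (auto simp: A_def)
  have "\<exists>\<mu>. \<mu> \<in> invariant_measures d \<phi> n \<and> from_nat_into C k \<in> supp (KQ n) \<mu>" for k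
    using from_nat_into[OF \<open>C \<noteq> {}\<close>, of k] C(2) by (auto simp: A_def attractor_def)
  then obtain M where M: "\<And>k. M k \<in> invariant_measures d \<phi> n"
      "\<And>k. from_nat_into C k \<in> supp (KQ n) (M k)"
    by metis
  obtain \<nu> where \<nu>: "prob_space \<nu>" "sets \<nu> = sets (borel_sigma (KQ n))"
    "\<And>f. (\<And>k. preserved_by (M k) f) \<Longrightarrow> preserved_by \<nu> f"
    "\<And>k A. A \<in> sets (borel_sigma (KQ n)) \<Longrightarrow> emeasure (M k) A > 0 \<Longrightarrow> emeasure \<nu> A > 0"
    using countable_mixture[of M "borel_sigma (KQ n)"] M(1)
    unfolding invariant_measures_def by blast
  have "space \<nu> = topspace (KQ n)" using sets_eq_imp_space_eq[OF \<nu>(2)] by simp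
  then have inv: "\<nu> \<in> invariant_measures d \<phi> n"
    using M(1) \<nu>(1-3) by (auto simp: invariant_measures_def)
  \<comment> \<open>An open set around a point of \<open>C\<close> is charged by some
    \<open>M k\<close>, hence by \<open>\<nu>\<close>; closedness of the support then carries the
    inclusion from the dense set to \<open>A\<close>.\<close>
  have "C \<subseteq> supp (KQ n) \<nu>"
  proof
    fix x assume "x \<in> C"
    then obtain k where "x = from_nat_into C k" using C(1) by (metis from_nat_into_surj)
    then have "x \<in> supp (KQ n) (M k)" using M(2) by simp
    then show "x \<in> supp (KQ n) \<nu>" unfolding supp_def using \<nu>(4) openin_imp_borel_sigma by blast
  qed
  then have "KQ n closure_of C \<subseteq> supp (KQ n) \<nu>" by (intro closure_of_minimal closedin_supp)
  moreover have "A \<subseteq> KQ n closure_of C"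
    using C(2,3) by (metis closure_of_subtopology_subset)
  ultimately have "A \<subseteq> supp (KQ n) \<nu>" by blast
  moreover have "supp (KQ n) \<nu> \<subseteq> A" using inv by (auto simp: A_def attractor_def)
  ultimately show thesis using that inv by (auto simp: A_def)
qed

lemma closedin_attractor:
  assumes "second_countable (KQ n)"
  shows "closedin (KQ n) (attractor d \<phi> n)"
proof (cases "attractor d \<phi> n = {}")
  case False
  then show ?thesis using attractor_eq_supp[OF assms] closedin_supp by metis
qed simp

section \<open>The quotient spaces\<close>

text \<open>This is \<open>R^k\<close> for any integer \<open>k\<close>: classes are the orbits of
  this group action, so equality of classes means being related by one translate.\<close>

definition translate :: "int \<Rightarrow> (int \<Rightarrow> real) \<Rightarrow> int \<Rightarrow> real" where
  "translate k u = (\<lambda>i. u i + of_int k)"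

lemma translate_0 [simp]: "translate 0 u = u"
  by (simp add: translate_def)

lemma translate_translate [simp]: "translate k (translate l u) = translate (k + l) u"
  by (auto simp: translate_def)

lemma translate_in_K [simp]: "translate k u \<in> K n \<longleftrightarrow> u \<in> K n"
  by (simp add: K_def translate_def)

lemma config_class_eq_range: "config_class u = range (\<lambda>k. translate k u)"
  by (auto simp: config_class_def translate_def)

lemma config_class_eq_iff: "config_class u = config_class v \<longleftrightarrow> (\<exists>k. v = translate k u)"
proof
  assume "config_class u = config_class v"
  moreover have "v \<in> config_class v"
    unfolding config_class_eq_range by (rule range_eqI[where x = 0]) simp
  ultimately show "\<exists>k. v = translate k u" by (auto simp: config_class_eq_range)
next
  assume "\<exists>k. v = translate k u"
  then obtain k where k: "v = translate k u" by blast
  have "translate l u \<in> config_class v" for l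
    unfolding config_class_eq_range k by (rule range_eqI[where x = "l - k"]) simp
  moreover have "translate l v \<in> config_class u" for l
    unfolding config_class_eq_range k by (rule range_eqI[where x = "l + k"]) simp
  ultimately show "config_class u = config_class v" unfolding config_class_eq_range by blast
qed

lemma real_class_eq_iff: "real_class x = real_class y \<longleftrightarrow> (\<exists>k::int. y = x + of_int k)"
proof
  assume "real_class x = real_class y"
  moreover have "y \<in> real_class y" unfolding real_class_def by (auto intro!: exI[where x = 0])
  ultimately show "\<exists>k::int. y = x + of_int k" by (auto simp: real_class_def)
next
  assume "\<exists>k::int. y = x + of_int k"
  then obtain k :: int where k: "y = x + of_int k" by blast
  have "x + of_int l \<in> real_class y" for l :: int
    unfolding real_class_def k by (rule CollectI, rule exI[where x = "l - k"]) auto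
  moreover have "y + of_int l \<in> real_class x" for l :: int
    unfolding real_class_def k by (rule CollectI, rule exI[where x = "k + l"]) auto
  ultimately show "real_class x = real_class y" unfolding real_class_def by blast
qed

section \<open>Hausdorff separation of the circle and of configuration classes\<close>

lemma cis_eq_iff_int: "cis (2 * pi * x) = cis (2 * pi * y) \<longleftrightarrow> (\<exists>k::int. y = x + of_int k)"
proof -
  have cis_1: "cis t = 1 \<longleftrightarrow> cos t = 1" for t
    by (auto simp: complex_eq_iff cos_one_sin_zero)
  have "cis (2 * pi * x) = cis (2 * pi * y) \<longleftrightarrow> cis (2 * pi * (y - x)) = 1"
    by (auto simp: right_diff_distrib simp flip: cis_divide)
  also have "\<dots> \<longleftrightarrow> (\<exists>k::int. y = x + of_int k)"
    by (simp add: cis_1 cos_one_2pi_int) (auto simp: algebra_simps)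
  finally show ?thesis .
qed

text \<open>Constancy of \<open>f\<close> on the fibres of \<open>q\<close> yields a continuous map
  on the quotient, and its different values on different fibres make that map injective; a
  continuous injection into a Hausdorff space pulls separation back.\<close>

lemma Hausdorff_quotient_topology:
  assumes "Hausdorff_space Y" and f: "continuous_map S Y f"
    and q: "\<And>x y. x \<in> topspace S \<Longrightarrow> y \<in> topspace S \<Longrightarrow> q x = q y \<longleftrightarrow> f x = f y"
  shows "Hausdorff_space (quotient_topology S q)"
proof -
  define g where "g = f \<circ> inv_into (topspace S) q"
  have g: "g (q x) = f x" if "x \<in> topspace S" for x
    unfolding g_def o_def using that q
    by (metis f_inv_into_f imageI inv_into_into)
  have "continuous_map S Y (g \<circ> q)" using f by (rule continuous_map_eq) (simp add: g)
  then have "continuous_map (quotient_topology S q) Y g"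
    by (rule continuous_compose_quotient_map[OF quotient_map_quotient_topology])
  moreover have "inj_on g (topspace (quotient_topology S q))" by (auto simp: inj_on_def g q)
  ultimately show ?thesis using assms(1) by (rule Hausdorff_space_injective_preimage[rotated])
qed

lemma Hausdorff_circle: "Hausdorff_space circle"
  unfolding circle_def
proof (rule Hausdorff_quotient_topology)
  show "continuous_map euclideanreal euclidean (\<lambda>x. cis (2 * pi * x))"
    by (auto intro!: continuous_intros)
  show "real_class x = real_class y \<longleftrightarrow> cis (2 * pi * x) = cis (2 * pi * y)" for x y
    by (simp add: real_class_eq_iff cis_eq_iff_int)
qed simp

lemma Hausdorff_KQ: "Hausdorff_space (KQ n)"
  unfolding KQ_def
proof (rule Hausdorff_quotient_topology)
  \<comment> \<open>A complete invariant of the class: the position of \<open>u 0\<close> on the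
    circle, together with the differences, which a common integer translation leaves
    unchanged.\<close>
  show "continuous_map (top_of_set (K n)) euclidean (\<lambda>u. (cis (2 * pi * u 0), \<lambda>i. u i - u 0))"
    unfolding continuous_map_iff_continuous
    by (intro continuous_on_Pair continuous_on_cis continuous_on_coordinatewise_then_product
        continuous_on_diff continuous_on_mult_left
        continuous_on_product_then_coordinatewise[OF continuous_on_id])
  show "config_class u = config_class v \<longleftrightarrow>
      (cis (2 * pi * u 0), \<lambda>i. u i - u 0) = (cis (2 * pi * v 0), \<lambda>i. v i - v 0)" for u v
  proof -
    have "v = (\<lambda>i. u i + of_int k)" if "v 0 = u 0 + of_int k" "(\<lambda>i. u i - u 0) = (\<lambda>i. v i - v 0)"
      for k :: int
    proof
      fix i
      have "u i - u 0 = v i - v 0" using that(2) by meson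
      then show "v i = u i + of_int k" using that(1) by simp
    qed
    then show ?thesis by (auto simp: config_class_eq_iff translate_def cis_eq_iff_int)
  qed
qed simp

lemma topspace_KQ: "topspace (KQ n) = config_class ` K n"
  by (simp add: KQ_def)

lemma quotient_map_config_class: "quotient_map (top_of_set (K n)) (KQ n) config_class"
  unfolding KQ_def by (rule quotient_map_quotient_topology)

lemma continuous_on_translate: "continuous_on S (translate k)"
  unfolding translate_def
  by (intro continuous_on_coordinatewise_then_product continuous_on_add continuous_on_const
      continuous_on_product_then_coordinatewise[OF continuous_on_id])

text \<open>The saturation of an open set is the union of its integer translates. Openness, stronger
  than the quotient property, passes second countability to \<open>KQ n\<close> and survives
  products with a time factor.\<close>

lemma open_map_config_class: "open_map (top_of_set (K n)) (KQ n) config_class"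
  unfolding open_map_def
proof (intro allI impI)
  fix U assume U: "openin (top_of_set (K n)) U"
  then have "U \<subseteq> K n" by (rule openin_imp_subset)
  have "openin (top_of_set (K n)) {u \<in> K n. translate k u \<in> U}" for k
  proof -
    have "continuous_map (top_of_set (K n)) (top_of_set (K n)) (translate k)"
      by (auto simp: continuous_map_in_subtopology continuous_on_translate)
    from openin_continuous_map_preimage[OF this U] show ?thesis by simp
  qed
  moreover have "{u \<in> K n. config_class u \<in> config_class ` U} = (\<Union>k. {u \<in> K n. translate k u \<in> U})"
  proof (intro equalityI subsetI)
    fix u assume "u \<in> {u \<in> K n. config_class u \<in> config_class ` U}"
    then obtain v where "u \<in> K n" "v \<in> U" "config_class u = config_class v" by auto
    then show "u \<in> (\<Union>k. {u \<in> K n. translate k u \<in> U})" by (auto simp: config_class_eq_iff)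
  next
    fix u assume "u \<in> (\<Union>k. {u \<in> K n. translate k u \<in> U})"
    then obtain k where "u \<in> K n" "translate k u \<in> U" by auto
    moreover have "config_class u = config_class (translate k u)" by (auto simp: config_class_eq_iff)
    ultimately show "u \<in> {u \<in> K n. config_class u \<in> config_class ` U}" by auto
  qed
  ultimately have "openin (top_of_set (K n)) {u \<in> K n. config_class u \<in> config_class ` U}" by auto
  then show "openin (KQ n) (config_class ` U)"
    using \<open>U \<subseteq> K n\<close> unfolding KQ_def openin_quotient_topology by auto
qed

lemma second_countable_KQ: "second_countable (KQ n)"
proof (rule second_countable_open_map_image)
  show "continuous_map (top_of_set (K n)) (KQ n) config_class"
    using quotient_map_config_class by (rule quotient_imp_continuous_map)
  have "second_countable (euclidean :: (int \<Rightarrow> real) topology)"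
  proof -
    obtain \<B> :: "(int \<Rightarrow> real) set set" where \<B>: "countable \<B>" "topological_basis \<B>"
      using ex_countable_basis by blast
    have "\<exists>V\<in>\<B>. x \<in> V \<and> V \<subseteq> U" if "open U" "x \<in> U" for U x
      by (rule topological_basisE[OF \<B>(2) that]) blast
    moreover have "open V" if "V \<in> \<B>" for V using \<B>(2) that by (rule topological_basis_open)
    ultimately show ?thesis
      unfolding second_countable_def using \<B>(1) by (intro exI[of _ \<B>]) simp
  qed
  then show "second_countable (top_of_set (K n))" by (rule second_countable_subtopology)
qed (simp_all add: open_map_config_class topspace_KQ)

section \<open>Linear growth and compactness\<close>

lemma K_growth:
  assumes "u \<in> K n"
  shows "\<bar>u j - u 0\<bar> \<le> real n * \<bar>of_int j\<bar>"
proof (induction j rule: int_induct[where k = 0])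
  case (step1 i)
  have "\<bar>u (i + 1) - u i\<bar> \<le> real n" using assms by (simp add: K_def)
  then show ?case using step1 by (simp add: algebra_simps)
next
  case (step2 i)
  have "\<bar>u (i - 1 + 1) - u (i - 1)\<bar> \<le> real n" using assms unfolding K_def by blast
  then show ?case using step2 by (simp add: algebra_simps)
qed simp

lemma closed_K: "closed (K n)"
proof -
  have "K n = (\<Inter>i. {u. \<bar>u (i + 1) - u i\<bar> \<le> real n})" by (auto simp: K_def)
  also have "closed \<dots>"
    by (intro closed_INT ballI closed_Collect_le continuous_on_rabs continuous_on_diff
        continuous_on_const continuous_on_product_then_coordinatewise[OF continuous_on_id])
  finally show ?thesis .
qed

text \<open>Each class meets the slice \<open>D\<close> where \<open>u 0\<close> lies in the unit
  interval. There the growth bound confines every coordinate to a fixed compact interval, so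
  \<open>D\<close> is a closed part of a Tychonoff product.\<close>

lemma compact_space_KQ: "compact_space (KQ n)"
proof -
  define B where "B i = {- real n * \<bar>of_int i\<bar>..1 + real n * \<bar>of_int i\<bar>}" for i :: int
  define D where "D = K n \<inter> {u. u 0 \<in> {0..1}}"
  have "compactin (product_topology (\<lambda>i::int. euclideanreal) UNIV) (PiE UNIV B)"
    by (simp add: compactin_PiE B_def)
  then have "compact (PiE UNIV B)" by (simp add: euclidean_product_topology)
  moreover have "closed {u :: int \<Rightarrow> real. u 0 \<in> {0..1}}"
    unfolding atLeastAtMost_iff
    by (intro closed_Collect_conj closed_Collect_le continuous_on_const
        continuous_on_product_then_coordinatewise[OF continuous_on_id])
  moreover have "D \<subseteq> PiE UNIV B"
  proof
    fix u assume "u \<in> D"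
    then have "u i \<in> B i" for i using K_growth[of u n i] by (auto simp: D_def B_def)
    then show "u \<in> PiE UNIV B" by auto
  qed
  moreover have "PiE UNIV B \<inter> (K n \<inter> {u. u 0 \<in> {0..1}}) = D"
    using \<open>D \<subseteq> PiE UNIV B\<close> by (auto simp: D_def)
  ultimately have "compact D" by (metis closed_Int closed_K compact_Int_closed)
  then have "compactin (top_of_set (K n)) D" by (auto simp: compactin_subtopology D_def)
  then have "compactin (KQ n) (config_class ` D)"
    using quotient_imp_continuous_map[OF quotient_map_config_class] by (rule image_compactin)
  moreover have "config_class ` D = topspace (KQ n)"
    unfolding topspace_KQ
  proof (intro equalityI subsetI)
    fix C assume "C \<in> config_class ` K n"
    then obtain u where u: "u \<in> K n" "C = config_class u" by auto
    have "translate (- \<lfloor>u 0\<rfloor>) u \<in> D"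
      using u(1) by (auto simp: D_def translate_def[THEN fun_cong]) linarith+
    moreover have "C = config_class (translate (- \<lfloor>u 0\<rfloor>) u)"
      using u(2) by (auto simp: config_class_eq_iff)
    ultimately show "C \<in> config_class ` D" by blast
  qed (auto simp: D_def)
  ultimately show ?thesis by (simp add: compact_space_def)
qed

lemma continuous_map_proj: "continuous_map (KQ n) (prod_topology circle euclideanreal) proj"
proof (rule continuous_compose_quotient_map[OF quotient_map_config_class])
  have coord: "continuous_map (top_of_set (K n)) euclideanreal (\<lambda>u. u i)" for i
    unfolding continuous_map_iff_continuous
    by (rule continuous_on_product_then_coordinatewise) (rule continuous_on_id)
  have "continuous_map euclideanreal circle real_class"
    unfolding circle_def by (intro quotient_imp_continuous_map quotient_map_quotient_topology)
  with coord[of 0] have "continuous_map (top_of_set (K n)) circle (real_class \<circ> (\<lambda>u. u 0))"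
    by (rule continuous_map_compose)
  moreover have "continuous_map (top_of_set (K n)) euclideanreal (\<lambda>u. u 1 - u 0)"
    by (intro continuous_map_diff coord)
  ultimately show "continuous_map (top_of_set (K n)) (prod_topology circle euclideanreal)
      (proj \<circ> config_class)"
    by (simp add: continuous_map_pairwise o_def proj_config_class)
qed

text \<open>A product of a quotient map with an identity may fail to be a quotient map, but open
  maps carry basic rectangles to open rectangles. This is how joint continuity in time and
  configuration descends to classes.\<close>

lemma open_map_prod_id:
  assumes "open_map S T q"
  shows "open_map (prod_topology Z S) (prod_topology Z T) (\<lambda>(t, x). (t, q x))"
  unfolding open_map_def
proof (intro allI impI)
  fix W assume W: "openin (prod_topology Z S) W"
  show "openin (prod_topology Z T) ((\<lambda>(t, x). (t, q x)) ` W)"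
    unfolding openin_prod_topology_alt
  proof (intro allI impI)
    fix t y assume "(t, y) \<in> (\<lambda>(t, x). (t, q x)) ` W"
    then obtain x where x: "(t, x) \<in> W" "y = q x" by auto
    then obtain U V where "openin Z U" "openin S V" "t \<in> U" "x \<in> V" "U \<times> V \<subseteq> W"
      using W[unfolded openin_prod_topology_alt, rule_format, OF x(1)] by blast
    moreover have "openin T (q ` V)" using assms \<open>openin S V\<close> by (simp add: open_map_def)
    ultimately show "\<exists>U V. openin Z U \<and> openin T V \<and> t \<in> U \<and> y \<in> V \<and>
        U \<times> V \<subseteq> (\<lambda>(t, x). (t, q x)) ` W"
      using x(2) by (intro exI[of _ U] exI[of _ "q ` V"]) auto
  qed
qed

lemma quotient_map_prod_config_class:
  "quotient_map (prod_topology Z (top_of_set (K n))) (prod_topology Z (KQ n))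
     (\<lambda>(t, u). (t, config_class u))"
proof (rule continuous_open_imp_quotient_map)
  have "continuous_map (prod_topology Z (top_of_set (K n))) (KQ n) (config_class \<circ> snd)"
    by (intro continuous_map_compose[OF continuous_map_snd]
        quotient_imp_continuous_map[OF quotient_map_config_class])
  then show "continuous_map (prod_topology Z (top_of_set (K n))) (prod_topology Z (KQ n))
      (\<lambda>(t, u). (t, config_class u))"
    by (simp add: continuous_map_pairwise o_def case_prod_beta continuous_map_fst)
  show "open_map (prod_topology Z (top_of_set (K n))) (prod_topology Z (KQ n))
      (\<lambda>(t, u). (t, config_class u))"
    by (rule open_map_prod_id[OF open_map_config_class])
  show "(\<lambda>(t, u). (t, config_class u)) ` topspace (prod_topology Z (top_of_set (K n)))
      = topspace (prod_topology Z (KQ n))"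
    by (auto simp: topspace_KQ image_iff)
qed

lemma image_config_class:
  assumes "\<And>k. f (translate k u) = translate k (f u)"
  shows "f ` config_class u = config_class (f u)"
  unfolding config_class_eq_range image_image using assms by simp

section \<open>Lipschitz estimates on diagonal strips\<close>

text \<open>Both sides select a value by the same predicate, so the equation holds even at points
  without a derivative, and periodicity passes from a function to its partial derivatives.\<close>

lemma deriv_shift: "deriv f (x + c) = deriv (\<lambda>y. f (y + c)) (x :: real)"
  unfolding deriv_def by (simp add: DERIV_shift)

lemma D1_diagonal_periodic:
  assumes "\<And>u v. f (u + 1) (v + 1) = f u v"
  shows "D1 f (u + 1) (v + 1) = D1 f u v"
  unfolding D1_def deriv_shift assms ..

lemma D2_diagonal_periodic:
  assumes "\<And>u v. f (u + 1) (v + 1) = f u v"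
  shows "D2 f (u + 1) (v + 1) = D2 f u v"
  unfolding D2_def deriv_shift assms ..

lemma diagonal_periodic_int:
  fixes g :: "real \<Rightarrow> real \<Rightarrow> 'a"
  assumes "\<And>u v. g (u + 1) (v + 1) = g u v"
  shows "g (u + of_int k) (v + of_int k) = g u v"
proof (induction k rule: int_induct[where k = 0])
  case (step1 i)
  have "g (u + of_int (i + 1)) (v + of_int (i + 1)) = g ((u + of_int i) + 1) ((v + of_int i) + 1)"
    by (simp add: add.assoc)
  then show ?case using assms step1 by simp
next
  case (step2 i)
  have "g (u + of_int i) (v + of_int i)
      = g ((u + of_int (i - 1)) + 1) ((v + of_int (i - 1)) + 1)"
    by simp
  also have "\<dots> = g (u + of_int (i - 1)) (v + of_int (i - 1))" by (rule assms)
  finally show ?case using step2 by simp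
qed simp

text \<open>Translation along the diagonal by the integer part of \<open>u\<close> brings
  \<open>u\<close> into the unit interval and keeps \<open>v - u\<close>, so one compact rectangle
  sees every value of \<open>g\<close> on the strip.\<close>

lemma bounded_on_strip:
  fixes g :: "real \<Rightarrow> real \<Rightarrow> real"
  assumes cont: "continuous_on UNIV (\<lambda>(u, v). g u v)"
    and per: "\<And>u v. g (u + 1) (v + 1) = g u v"
  obtains B where "B \<ge> 0" "\<And>u v. \<bar>v - u\<bar> \<le> r \<Longrightarrow> \<bar>g u v\<bar> \<le> B"
proof -
  have "compact ((\<lambda>(u, v). g u v) ` ({0..1} \<times> {- r..1 + r}))"
    by (intro compact_continuous_image continuous_on_subset[OF cont] compact_Times) auto
  then obtain B where B: "\<And>u v. u \<in> {0..1} \<Longrightarrow> v \<in> {- r..1 + r} \<Longrightarrow> \<bar>g u v\<bar> \<le> B"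
    by (force dest!: compact_imp_bounded simp: bounded_iff)
  show thesis
  proof
    fix u v :: real assume uv: "\<bar>v - u\<bar> \<le> r"
    define k where "k = \<lfloor>u\<rfloor>"
    have "u - of_int k \<in> {0..1}" "v - of_int k \<in> {- r..1 + r}"
      using uv unfolding k_def by (auto simp: abs_le_iff) linarith+
    then have "\<bar>g (u - of_int k) (v - of_int k)\<bar> \<le> B" by (rule B)
    also have "g (u - of_int k) (v - of_int k) = g u v"
      using diagonal_periodic_int[of g u "- k" v] per by simp
    \<comment> \<open>For \<open>r < - 1 / 2\<close> the rectangle is empty and \<open>B\<close> may
      be negative, hence the maximum.\<close>
    finally show "\<bar>g u v\<bar> \<le> max B 0" by simp
  qed simp
qed

text \<open>The difference is split at a corner, with the mean value inequality on each leg. The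
  corner may leave the strip; when it could do so by more than 1, the distance exceeds 1 and
  boundedness of \<open>g\<close> suffices.\<close>

lemma lipschitz_on_strip:
  fixes g :: "real \<Rightarrow> real \<Rightarrow> real"
  assumes C1: "C1_plane g" and cont: "continuous_on UNIV (\<lambda>(u, v). g u v)"
    and per: "\<And>u v. g (u + 1) (v + 1) = g u v"
  obtains L where "L \<ge> 0"
    "\<And>u v u' v'. \<bar>v - u\<bar> \<le> r \<Longrightarrow> \<bar>v' - u'\<bar> \<le> r \<Longrightarrow>
       \<bar>g u v - g u' v'\<bar> \<le> L * (\<bar>u - u'\<bar> + \<bar>v - v'\<bar>)"
proof -
  obtain B where B: "B \<ge> 0" "\<And>u v. \<bar>v - u\<bar> \<le> r \<Longrightarrow> \<bar>g u v\<bar> \<le> B"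
    using bounded_on_strip[OF cont per] by blast
  obtain B1 where B1: "B1 \<ge> 0" "\<And>u v. \<bar>v - u\<bar> \<le> r + 1 \<Longrightarrow> \<bar>D1 g u v\<bar> \<le> B1"
    using bounded_on_strip[of "D1 g" "r + 1"] C1 D1_diagonal_periodic[of g, OF per]
    unfolding C1_plane_def by blast
  obtain B2 where B2: "B2 \<ge> 0" "\<And>u v. \<bar>v - u\<bar> \<le> r + 1 \<Longrightarrow> \<bar>D2 g u v\<bar> \<le> B2"
    using bounded_on_strip[of "D2 g" "r + 1"] C1 D2_diagonal_periodic[of g, OF per]
    unfolding C1_plane_def by blast
  \<comment> \<open>\<open>B1\<close> and \<open>B2\<close> serve the two legs of the near case,
    \<open>2 * B\<close> the far case.\<close>
  define L where "L = 2 * B + B1 + B2"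
  show thesis
  proof
    show "L \<ge> 0" using B(1) B1(1) B2(1) by (simp add: L_def)
    fix u v u' v' :: real
    assume uv: "\<bar>v - u\<bar> \<le> r" and uv': "\<bar>v' - u'\<bar> \<le> r"
    show "\<bar>g u v - g u' v'\<bar> \<le> L * (\<bar>u - u'\<bar> + \<bar>v - v'\<bar>)"
    proof (cases "\<bar>u - u'\<bar> \<le> 1")
      \<comment> \<open>The corner \<open>(u', v)\<close> lies in the strip of width \<open>r + 1\<close>.\<close>
      case True
      have d1: "((\<lambda>x. g x v) has_field_derivative D1 g z v) (at z within S)" for z v S
        using C1 unfolding C1_plane_def D1_def
        by (meson DERIV_deriv_iff_field_differentiable has_field_derivative_at_within)
      have d2: "((\<lambda>y. g u y) has_field_derivative D2 g u z) (at z within S)" for z u S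
        using C1 unfolding C1_plane_def D2_def
        by (meson DERIV_deriv_iff_field_differentiable has_field_derivative_at_within)
      have "norm (g u v - g u' v) \<le> B1 * norm (u - u')"
      proof (rule field_differentiable_bound[OF convex_closed_segment, of u u'])
        fix z assume "z \<in> closed_segment u u'"
        then have "\<bar>v - z\<bar> \<le> r + 1"
          using uv True by (auto simp: closed_segment_eq_real_ivl split: if_splits)
        then show "norm (D1 g z v) \<le> B1" using B1(2) by simp
      qed (use d1 in auto)
      moreover have "norm (g u' v - g u' v') \<le> B2 * norm (v - v')"
      proof (rule field_differentiable_bound[OF convex_closed_segment, of v v'])
        fix z assume "z \<in> closed_segment v v'"
        then have "\<bar>z - u'\<bar> \<le> r + 1"
          using uv uv' True by (auto simp: closed_segment_eq_real_ivl split: if_splits)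
        then show "norm (D2 g u' z) \<le> B2" using B2(2) by simp
      qed (use d2 in auto)
      moreover have "B1 * \<bar>u - u'\<bar> \<le> L * \<bar>u - u'\<bar>" "B2 * \<bar>v - v'\<bar> \<le> L * \<bar>v - v'\<bar>"
        using B(1) B1(1) B2(1) by (auto simp: L_def intro!: mult_right_mono)
      ultimately show ?thesis unfolding real_norm_def distrib_left by linarith
    next
      case False
      have "\<bar>g u v - g u' v'\<bar> \<le> 2 * B * 1" using B(2)[OF uv] B(2)[OF uv'] by simp
      also have "\<dots> \<le> L * (\<bar>u - u'\<bar> + \<bar>v - v'\<bar>)"
        using False B(1) B1(1) B2(1) by (intro mult_mono) (auto simp: L_def)
      finally show ?thesis .
    qed
  qed
qed

section \<open>Solutions of the lattice equation\<close>

text \<open>The right-hand side without \<open>F\<close>: the forcing is common to all sites and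
  solutions and cancels in the differences estimated below.\<close>

definition lattice_field ::
  "(real \<Rightarrow> real \<Rightarrow> real) \<Rightarrow> (int \<Rightarrow> real) \<Rightarrow> int \<Rightarrow> real" where
  "lattice_field V u j = - D2 V (u (j - 1)) (u j) - D1 V (u j) (u (j + 1))"

text \<open>Separates solving the equation inside \<open>K n\<close> from the given
  \<open>\<phi>\<close>: translates, shifts and suitable delays of a solution are again of this
  kind, and uniqueness identifies them with values of \<open>\<phi>\<close>.\<close>

definition trajectory ::
  "(real \<Rightarrow> real \<Rightarrow> real) \<Rightarrow> (real \<Rightarrow> real) \<Rightarrow> nat \<Rightarrow> (real \<Rightarrow> int \<Rightarrow> real) \<Rightarrow> bool" where
  "trajectory V F n x \<longleftrightarrow> (\<forall>t\<ge>0. x t \<in> K n \<and>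
     (\<forall>j. ((\<lambda>s. x s j) has_real_derivative lattice_field V (x t) j + F t) (at t within {0..})))"

text \<open>Powers of 2 outgrow the linear bound on differences in \<open>K n\<close>, yet change by
  a factor of at most 2 from one site to the next.\<close>

definition weight :: "int \<Rightarrow> real" where
  "weight j = 2 ^ nat \<bar>j\<bar>"

lemma weight_ge_1 [simp]: "1 \<le> weight j"
  by (simp add: weight_def)

lemma weight_pos [simp]: "0 < weight j"
  by (simp add: weight_def)

lemma weight_neighbour:
  assumes "\<bar>i - j\<bar> \<le> 1"
  shows "weight i \<le> 2 * weight j"
proof -
  have "nat \<bar>i\<bar> \<le> Suc (nat \<bar>j\<bar>)" using assms by linarith
  then have "(2::real) ^ nat \<bar>i\<bar> \<le> 2 ^ Suc (nat \<bar>j\<bar>)" by (rule power_increasing) simp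
  then show ?thesis by (simp add: weight_def)
qed

lemma abs_le_weight: "\<bar>of_int j\<bar> \<le> weight j"
proof -
  have "real (nat \<bar>j\<bar>) < 2 ^ nat \<bar>j\<bar>" by (rule of_nat_less_two_power)
  then show ?thesis by (simp add: weight_def)
qed

text \<open>Each of the two terms at \<open>j\<close> reads site \<open>j\<close> and one neighbour,
  whose weight is at most twice that of \<open>j\<close>; so each contributes
  \<open>1 + 2 = 3\<close> times its Lipschitz constant on the strip.\<close>

lemma lattice_field_lipschitz:
  assumes "twist_potential V"
  obtains L where "L \<ge> 0"
    "\<And>u v M j. u \<in> K n \<Longrightarrow> v \<in> K n \<Longrightarrow> (\<And>i. \<bar>u i - v i\<bar> \<le> M * weight i) \<Longrightarrow>
       \<bar>lattice_field V u j - lattice_field V v j\<bar> \<le> L * M * weight j"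
proof -
  from assms have C: "C1_plane V" "C1_plane (D1 V)" "C1_plane (D2 V)"
    and per: "\<And>u v. V (u + 1) (v + 1) = V u v"
    by (auto simp: twist_potential_def C2_plane_def)
  obtain L1 where L1: "L1 \<ge> 0" "\<And>u v u' v'. \<bar>v - u\<bar> \<le> real n \<Longrightarrow> \<bar>v' - u'\<bar> \<le> real n \<Longrightarrow>
       \<bar>D1 V u v - D1 V u' v'\<bar> \<le> L1 * (\<bar>u - u'\<bar> + \<bar>v - v'\<bar>)"
  proof (rule lipschitz_on_strip[OF C(2), where r = "real n"])
    show "continuous_on UNIV (\<lambda>(u, v). D1 V u v)" using C(1) by (simp add: C1_plane_def)
    show "D1 V (u + 1) (v + 1) = D1 V u v" for u v by (rule D1_diagonal_periodic[of V, OF per])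
  qed (rule that; blast)
  obtain L2 where L2: "L2 \<ge> 0" "\<And>u v u' v'. \<bar>v - u\<bar> \<le> real n \<Longrightarrow> \<bar>v' - u'\<bar> \<le> real n \<Longrightarrow>
       \<bar>D2 V u v - D2 V u' v'\<bar> \<le> L2 * (\<bar>u - u'\<bar> + \<bar>v - v'\<bar>)"
  proof (rule lipschitz_on_strip[OF C(3), where r = "real n"])
    show "continuous_on UNIV (\<lambda>(u, v). D2 V u v)" using C(1) by (simp add: C1_plane_def)
    show "D2 V (u + 1) (v + 1) = D2 V u v" for u v by (rule D2_diagonal_periodic[of V, OF per])
  qed (rule that; blast)
  show thesis
  proof
    show "3 * L1 + 3 * L2 \<ge> 0" using L1(1) L2(1) by simp
    fix u v M and j :: int
    assume u: "u \<in> K n" and v: "v \<in> K n" and *: "\<And>i. \<bar>u i - v i\<bar> \<le> M * weight i"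
    have "0 \<le> M * weight 0" using *[of 0] by linarith
    then have M: "M \<ge> 0" by (simp add: zero_le_mult_iff weight_def)
    have near: "\<bar>u i - v i\<bar> \<le> 2 * M * weight j" if "\<bar>i - j\<bar> \<le> 1" for i
      using *[of i] mult_left_mono[OF weight_neighbour[OF that] M] by simp
    have K': "\<bar>w j - w (j - 1)\<bar> \<le> real n" "\<bar>w (j + 1) - w j\<bar> \<le> real n" if "w \<in> K n" for w
    proof -
      show "\<bar>w (j + 1) - w j\<bar> \<le> real n" using that by (simp add: K_def)
      have "\<bar>w (j - 1 + 1) - w (j - 1)\<bar> \<le> real n" using that unfolding K_def by blast
      then show "\<bar>w j - w (j - 1)\<bar> \<le> real n" by simp
    qed
    have "\<bar>D1 V (u j) (u (j + 1)) - D1 V (v j) (v (j + 1))\<bar>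
        \<le> L1 * (\<bar>u j - v j\<bar> + \<bar>u (j + 1) - v (j + 1)\<bar>)"
      by (intro L1(2) K' u v)
    also have "\<dots> \<le> L1 * (M * weight j + 2 * M * weight j)"
      by (intro mult_left_mono add_mono * near L1(1)) simp
    finally have 1: "\<bar>D1 V (u j) (u (j + 1)) - D1 V (v j) (v (j + 1))\<bar> \<le> 3 * L1 * (M * weight j)"
      by (simp add: algebra_simps)
    have "\<bar>D2 V (u (j - 1)) (u j) - D2 V (v (j - 1)) (v j)\<bar>
        \<le> L2 * (\<bar>u (j - 1) - v (j - 1)\<bar> + \<bar>u j - v j\<bar>)"
      by (intro L2(2) K' u v)
    also have "\<dots> \<le> L2 * (2 * M * weight j + M * weight j)"
      by (intro mult_left_mono add_mono * near L2(1)) simp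
    finally have 2: "\<bar>D2 V (u (j - 1)) (u j) - D2 V (v (j - 1)) (v j)\<bar> \<le> 3 * L2 * (M * weight j)"
      by (simp add: algebra_simps)
    have "(3 * L1 + 3 * L2) * M * weight j = 3 * L1 * (M * weight j) + 3 * L2 * (M * weight j)"
      by (simp add: algebra_simps)
    with 1 2 show "\<bar>lattice_field V u j - lattice_field V v j\<bar> \<le> (3 * L1 + 3 * L2) * M * weight j"
      unfolding lattice_field_def by linarith
  qed
qed

lemma trajectory_continuous:
  assumes "trajectory V F n x" "S \<subseteq> {0..}"
  shows "continuous_on S (\<lambda>t. x t j)"
proof (rule DERIV_continuous_on)
  fix t assume "t \<in> S"
  then have "((\<lambda>s. x s j) has_real_derivative lattice_field V (x t) j + F t) (at t within {0..})"
    using assms by (auto simp: trajectory_def)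
  then show "((\<lambda>s. x s j) has_real_derivative lattice_field V (x t) j + F t) (at t within S)"
    using assms(2) by (rule DERIV_subset)
qed

text \<open>On a short time interval the weighted supremum \<open>M\<close> of the distance satisfies
  \<open>M \<le> c + M / 2\<close>. It is finite because configurations in \<open>K n\<close> grow at most linearly.\<close>

lemma trajectory_distance_short:
  assumes "twist_potential V"
  obtains h where "h > 0"
    "\<And>F x y s t c j. trajectory V F n x \<Longrightarrow> trajectory V F n y \<Longrightarrow> 0 \<le> s \<Longrightarrow> 0 \<le> t \<Longrightarrow>
       \<bar>t - s\<bar> \<le> h \<Longrightarrow> (\<And>i. \<bar>x s i - y s i\<bar> \<le> c * weight i) \<Longrightarrow>
       \<bar>x t j - y t j\<bar> \<le> 2 * c * weight j"
proof -
  obtain L where L: "L \<ge> 0"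
    "\<And>u v M j. u \<in> K n \<Longrightarrow> v \<in> K n \<Longrightarrow> (\<And>i. \<bar>u i - v i\<bar> \<le> M * weight i) \<Longrightarrow>
       \<bar>lattice_field V u j - lattice_field V v j\<bar> \<le> L * M * weight j"
    by (rule lattice_field_lipschitz[OF assms, where n = n]) (rule that; blast)
  \<comment> \<open>The goal is \<open>L * h \<le> 1 / 2\<close>, which absorbs half of the
    supremum; the added 1 keeps the denominator nonzero when \<open>L = 0\<close>.\<close>
  define h where "h = 1 / (2 * (L + 1))"
  have h: "h > 0" "L * h \<le> 1 / 2" using L(1) by (auto simp: h_def field_simps)
  show thesis
  proof
    show "h > 0" by (fact h)
    fix F x y s t c and j :: int
    assume x: "trajectory V F n x" and y: "trajectory V F n y" and st: "0 \<le> s" "0 \<le> t" "\<bar>t - s\<bar> \<le> h"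
      and c: "\<And>i. \<bar>x s i - y s i\<bar> \<le> c * weight i"
    \<comment> \<open>The segment does not depend on the order of its ends, so forward and backward
      times are estimated at once.\<close>
    define S where "S = closed_segment s t"
    define w where "w r i = x r i - y r i" for r i
    have S: "S \<subseteq> {0..}" "s \<in> S" "t \<in> S" "compact S" and S_near: "\<And>r. r \<in> S \<Longrightarrow> \<bar>r - s\<bar> \<le> h"
      using st by (auto simp: S_def closed_segment_eq_real_ivl split: if_splits)
    \<comment> \<open>Compactness in time is applied at site 0 alone; the growth bound of
      \<open>K n\<close> spreads the estimate to the other sites and makes the supremum below
      finite.\<close>
    have "compact ((\<lambda>r. w r 0) ` S)"
      unfolding w_def by (intro compact_continuous_image continuous_intros
          trajectory_continuous[OF x] trajectory_continuous[OF y] S)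
    then obtain B where B: "\<And>r. r \<in> S \<Longrightarrow> \<bar>w r 0\<bar> \<le> B"
      by (force dest!: compact_imp_bounded simp: bounded_iff)
    define q where "q = (\<lambda>(r, i). \<bar>w r i\<bar> / weight i)"
    have q_le: "q (r, i) \<le> B + 2 * real n" if "r \<in> S" for r i
    proof -
      have "x r \<in> K n" "y r \<in> K n" using x y S(1) that by (auto simp: trajectory_def)
      then have "\<bar>w r i\<bar> \<le> B + 2 * real n * \<bar>of_int i\<bar>"
        using K_growth[of "x r" n i] K_growth[of "y r" n i] B[OF that] unfolding w_def by linarith
      also have "\<dots> \<le> B * weight i + 2 * real n * weight i"
        using B[OF that] mult_left_mono[OF weight_ge_1[of i], of B]
          mult_left_mono[OF abs_le_weight[of i], of "2 * real n"] by (simp add: add_mono)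
      finally show ?thesis by (simp add: q_def field_simps)
    qed
    then have bdd: "bdd_above (q ` (S \<times> UNIV))" by (auto intro!: bdd_aboveI2)
    define M where "M = (SUP p\<in>S \<times> UNIV. q p)"
    have M: "\<bar>w r i\<bar> \<le> M * weight i" if "r \<in> S" for r i
    proof -
      have "q (r, i) \<le> M" unfolding M_def using that by (intro cSUP_upper bdd) auto
      then show ?thesis by (simp add: q_def field_simps)
    qed
    have "M \<le> c + M / 2"
      unfolding M_def
    proof (rule cSUP_least)
      fix p :: "real \<times> int" assume "p \<in> S \<times> UNIV"
      then obtain r i where p: "p = (r, i)" "r \<in> S" by auto
      have "norm (w r i - w s i) \<le> (L * M * weight i) * norm (r - s)"
      proof (rule field_differentiable_bound)
        show "convex S" by (simp add: S_def)
        fix z assume z: "z \<in> S"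
        then have "0 \<le> z" using S(1) by auto
        then have "((\<lambda>s. w s i) has_field_derivative
            (lattice_field V (x z) i + F z) - (lattice_field V (y z) i + F z)) (at z within {0..})"
          using x y unfolding w_def trajectory_def by (intro DERIV_diff) auto
        then show "((\<lambda>s. w s i) has_field_derivative
            (lattice_field V (x z) i - lattice_field V (y z) i)) (at z within S)"
          using S(1) by (auto intro: DERIV_subset)
        show "norm (lattice_field V (x z) i - lattice_field V (y z) i) \<le> L * M * weight i"
          using x y M[OF z] \<open>0 \<le> z\<close> unfolding trajectory_def real_norm_def w_def
          by (intro L(2)) auto
      qed (use p S in auto)
      also have "\<dots> \<le> (L * M * weight i) * h"
      proof (rule mult_left_mono)
        have "0 \<le> M * weight i" using M[OF p(2), of i] by linarith
        then show "0 \<le> L * M * weight i" using L(1) by (simp add: mult.assoc)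
      qed (use S_near[OF p(2)] in simp)
      also have "\<dots> = (L * h) * (M * weight i)" by simp
      also have "\<dots> \<le> 1 / 2 * (M * weight i)"
        using M[OF p(2), of i] by (intro mult_right_mono h) linarith
      finally have "\<bar>w r i\<bar> \<le> (c + M / 2) * weight i"
        using c[of i] unfolding w_def real_norm_def distrib_right by linarith
      then show "q p \<le> c + (SUP p\<in>S \<times> UNIV. q p) / 2"
        unfolding M_def[symmetric] by (simp add: p q_def field_simps)
    qed (use S in auto)
    then have "M * weight j \<le> 2 * c * weight j" by (intro mult_right_mono) (auto intro: less_imp_le)
    then show "\<bar>x t j - y t j\<bar> \<le> 2 * c * weight j" using M[OF S(3), of j] unfolding w_def by linarith
  qed
qed

text \<open>Cutting the time interval into \<open>k\<close> pieces of length at most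
  \<open>h\<close> costs one doubling per piece, a Gronwall bound with \<open>2 ^ k\<close> as its
  exponential.\<close>

lemma trajectory_distance:
  assumes "twist_potential V"
  obtains h where "h > 0"
    "\<And>F x y s t c j k. trajectory V F n x \<Longrightarrow> trajectory V F n y \<Longrightarrow> 0 \<le> s \<Longrightarrow> 0 \<le> t \<Longrightarrow>
       \<bar>t - s\<bar> \<le> real k * h \<Longrightarrow> (\<And>i. \<bar>x s i - y s i\<bar> \<le> c * weight i) \<Longrightarrow>
       \<bar>x t j - y t j\<bar> \<le> 2 ^ k * c * weight j"
proof -
  obtain h where h: "h > 0"
    "\<And>F x y s t c j. trajectory V F n x \<Longrightarrow> trajectory V F n y \<Longrightarrow> 0 \<le> s \<Longrightarrow> 0 \<le> t \<Longrightarrow>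
       \<bar>t - s\<bar> \<le> h \<Longrightarrow> (\<And>i. \<bar>x s i - y s i\<bar> \<le> c * weight i) \<Longrightarrow>
       \<bar>x t j - y t j\<bar> \<le> 2 * c * weight j"
    by (rule trajectory_distance_short[OF assms, where n = n]) (rule that; blast)
  have "\<bar>x t j - y t j\<bar> \<le> 2 ^ k * c * weight j"
    if "trajectory V F n x" "trajectory V F n y" "0 \<le> s" "0 \<le> t"
      "\<bar>t - s\<bar> \<le> real k * h" "\<And>i. \<bar>x s i - y s i\<bar> \<le> c * weight i" for F x y s t c j k
    using that
  proof (induction k arbitrary: s c)
    case 0
    then show ?case by simp
  next
    case (Suc k)
    \<comment> \<open>One of \<open>k + 1\<close> equal steps from \<open>s\<close> towards
      \<open>t\<close>, in whichever direction; the other \<open>k\<close> steps start from the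
      constant \<open>2 * c\<close>.\<close>
    define s' where "s' = s + (t - s) / (1 + real k)"
    have s': "s' = (real k * s + t) / (1 + real k)" by (simp add: s'_def field_simps)
    have "0 \<le> s'" using Suc.prems by (simp add: s')
    have "\<bar>s' - s\<bar> \<le> h" using Suc.prems(5) by (simp add: s'_def field_simps)
    have "t - s' = (t - s) / (1 + real k) * real k" by (simp add: s'_def field_simps)
    then have "\<bar>t - s'\<bar> = \<bar>t - s\<bar> / (1 + real k) * real k" by (simp add: abs_mult)
    also have "\<dots> \<le> h * real k"
      using Suc.prems(5) by (intro mult_right_mono) (simp_all add: field_simps)
    finally have "\<bar>t - s'\<bar> \<le> real k * h" by (simp add: mult.commute)
    have "\<bar>x s' i - y s' i\<bar> \<le> 2 * c * weight i" for i
      by (rule h(2)) (use Suc.prems \<open>0 \<le> s'\<close> \<open>\<bar>s' - s\<bar> \<le> h\<close> in auto)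
    then have "\<bar>x t j - y t j\<bar> \<le> 2 ^ k * (2 * c) * weight j"
      by (rule Suc.IH[OF Suc.prems(1,2) \<open>0 \<le> s'\<close> Suc.prems(4) \<open>\<bar>t - s'\<bar> \<le> real k * h\<close>])
    then show ?case by (simp add: mult_ac)
  qed
  then show thesis using that h(1) by blast
qed

text \<open>The two times are in arbitrary order, so this includes backward uniqueness.\<close>

lemma trajectory_unique:
  assumes V: "twist_potential V" and x: "trajectory V F n x" and y: "trajectory V F n y"
    and "0 \<le> s" "0 \<le> t" and eq: "x s = y s"
  shows "x t = y t"
proof
  fix j
  obtain h where h: "h > 0"
    "\<And>F x y s t c j k. trajectory V F n x \<Longrightarrow> trajectory V F n y \<Longrightarrow> 0 \<le> s \<Longrightarrow> 0 \<le> t \<Longrightarrow>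
       \<bar>t - s\<bar> \<le> real k * h \<Longrightarrow> (\<And>i. \<bar>x s i - y s i\<bar> \<le> c * weight i) \<Longrightarrow>
       \<bar>x t j - y t j\<bar> \<le> 2 ^ k * c * weight j"
    by (rule trajectory_distance[OF V, where n = n]) (rule that; blast)
  obtain k where "\<bar>t - s\<bar> \<le> real k * h"
    using reals_Archimedean3[OF h(1)] by (meson less_imp_le)
  \<comment> \<open>Agreement at time \<open>s\<close> allows \<open>c = 0\<close>, which doublings
    do not change.\<close>
  then have "\<bar>x t j - y t j\<bar> \<le> 2 ^ k * 0 * weight j"
    by (intro h(2)[OF x y]) (use assms in auto)
  then show "x t j = y t j" by simp
qed

section \<open>Symmetries of the lattice equation: shift, integer translation, delay\<close>

lemma shift_in_K [simp]: "shift u \<in> K n \<longleftrightarrow> u \<in> K n"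
proof -
  have "\<bar>u i - u (i - 1)\<bar> \<le> real n" if "\<And>i. \<bar>u (i + 1) - u i\<bar> \<le> real n" for i
    using that[of "i - 1"] by simp
  moreover have "\<bar>u (i + 1) - u i\<bar> \<le> real n" if "\<And>i. \<bar>u i - u (i - 1)\<bar> \<le> real n" for i
    using that[of "i + 1"] by simp
  ultimately show ?thesis by (auto simp: K_def shift_def)
qed

lemma inj_shift: "inj shift"
  by (rule inj_on_inverseI[where g = "\<lambda>u i. u (i + 1)"]) (simp add: shift_def)

lemma shift_translate: "shift (translate k u) = translate k (shift u)"
  by (simp add: shift_def translate_def)

lemma K_subset_X: "K n \<subseteq> X"
proof
  fix u assume "u \<in> K n"
  \<comment> \<open>\<open>X\<close> is a union over \<open>n \<ge> 1\<close>, so \<open>K 0\<close>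
    has to be placed in \<open>K 1\<close>.\<close>
  then have "u \<in> K (max n 1)" unfolding K_def by (auto intro: order_trans)
  then show "u \<in> X" unfolding X_def by force
qed

lemma lattice_field_translate:
  assumes "twist_potential V"
  shows "lattice_field V (translate k u) j = lattice_field V u j"
proof -
  have "V (u + 1) (v + 1) = V u v" for u v using assms by (simp add: twist_potential_def)
  then show ?thesis
    unfolding lattice_field_def translate_def
    by (simp add: diagonal_periodic_int D1_diagonal_periodic D2_diagonal_periodic)
qed

lemma trajectory_translate:
  assumes "twist_potential V" "trajectory V F n x"
  shows "trajectory V F n (\<lambda>t. translate k (x t))"
proof -
  have "((\<lambda>s. x s j + of_int k) has_real_derivative lattice_field V (x t) j + F t)
      (at t within {0..})" if "t \<ge> 0" for t j
    using assms(2) that by (auto simp: trajectory_def intro!: derivative_eq_intros)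
  then have "((\<lambda>s. translate k (x s) j) has_real_derivative lattice_field V (x t) j + F t)
      (at t within {0..})" if "t \<ge> 0" for t j
    using that by (simp add: translate_def)
  then show ?thesis
    using assms unfolding trajectory_def by (simp add: lattice_field_translate)
qed

lemma trajectory_shift:
  assumes "trajectory V F n x"
  shows "trajectory V F n (\<lambda>t. shift (x t))"
proof -
  have "lattice_field V (shift u) j = lattice_field V u (j - 1)" for u j
    by (simp add: lattice_field_def shift_def)
  moreover have "((\<lambda>s. shift (x s) j) has_real_derivative lattice_field V (x t) (j - 1) + F t)
      (at t within {0..})" if "t \<ge> 0" for t j
    using assms that by (simp add: trajectory_def shift_def)
  ultimately show ?thesis using assms unfolding trajectory_def by simp
qed

text \<open>The condition on \<open>F\<close> says that \<open>s\<close> is a period of the forcing;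
  for constant forcing every delay qualifies. The semigroup law comes from here.\<close>

lemma trajectory_delay:
  assumes "trajectory V F n x" and F: "\<And>t. F (s + t) = F t" and "s \<ge> 0"
  shows "trajectory V F n (\<lambda>t. x (s + t))"
proof -
  have "((\<lambda>r. x (s + r) j) has_real_derivative lattice_field V (x (s + t)) j + F t)
      (at t within {0..})" if "t \<ge> 0" for t j
  proof -
    have "((\<lambda>r. x r j) has_real_derivative lattice_field V (x (s + t)) j + F t)
        (at (s + t) within {0..})"
    proof -
      have "0 \<le> s + t" using that \<open>s \<ge> 0\<close> by simp
      with assms(1) have "((\<lambda>r. x r j) has_real_derivative
          lattice_field V (x (s + t)) j + F (s + t)) (at (s + t) within {0..})"
        unfolding trajectory_def by blast
      then show ?thesis by (simp only: F)
    qed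
    \<comment> \<open>Delayed times \<open>{0..}\<close> correspond to the half-line from
      \<open>s\<close> on, a part of \<open>{0..}\<close>, so the one-sided derivative
      restricts.\<close>
    then have "((\<lambda>r. x r j) has_real_derivative lattice_field V (x (s + t)) j + F t)
        (at (s + t) within (+) s ` {0..})"
      by (rule DERIV_subset) (use \<open>s \<ge> 0\<close> in auto)
    from DERIV_at_within_shift_lemma[OF this] show ?thesis by (simp add: o_def)
  qed
  then show ?thesis using assms unfolding trajectory_def by simp
qed

text \<open>Nearness in the product topology controls finitely many sites. Beyond them the weight
  overtakes the linear bound, so on \<open>K n\<close> product convergence implies convergence in
  the weighted distance.\<close>

lemma eventually_weighted_close:
  assumes u: "u \<in> K n" and "\<epsilon> > 0"
  shows "eventually (\<lambda>v. \<forall>i. \<bar>v i - u i\<bar> \<le> \<epsilon> * weight i) (at u within K n)"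
proof -
  obtain N :: nat where N: "N > 0" "\<And>k. k \<ge> N \<Longrightarrow> 1 + 2 * real n * real k \<le> \<epsilon> * 2 ^ k"
  proof -
    have "(\<lambda>k. (1 + 2 * real n * real k) / 2 ^ k) \<longlonglongrightarrow> 0"
      by real_asymp
    then have "eventually (\<lambda>k. (1 + 2 * real n * real k) / 2 ^ k < \<epsilon>) sequentially"
      using \<open>\<epsilon> > 0\<close> by (auto dest: order_tendstoD(2))
    then obtain N where N: "\<And>k. k \<ge> N \<Longrightarrow> (1 + 2 * real n * real k) / 2 ^ k < \<epsilon>"
      by (auto simp: eventually_sequentially)
    have "1 + 2 * real n * real k \<le> \<epsilon> * 2 ^ k" if "k \<ge> Suc N" for k
      using N[of k] that by (simp add: pos_divide_less_eq)
    then show thesis using that[of "Suc N"] by blast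
  qed
  have close: "eventually (\<lambda>v. \<bar>v i - u i\<bar> < e) (at u within K n)" if "e > 0" for i e
  proof -
    have "continuous_on (K n) (\<lambda>v. v i)"
      by (rule continuous_on_product_then_coordinatewise) (rule continuous_on_id)
    then have "((\<lambda>v. v i) \<longlongrightarrow> u i) (at u within K n)" using u by (auto simp: continuous_on_def)
    from tendstoD[OF this that] show ?thesis by (simp add: dist_real_def)
  qed
  have "eventually (\<lambda>v. \<forall>i\<in>{- int N..int N}. \<bar>v i - u i\<bar> < \<epsilon>) (at u within K n)"
    using close[OF \<open>\<epsilon> > 0\<close>] by (intro eventually_ball_finite) auto
  \<comment> \<open>Feeds the tail: with site 0 within 1, the difference at \<open>i\<close> is at
    most \<open>1 + 2 * n * \<bar>i\<bar>\<close>, the quantity for which \<open>N\<close> was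
    chosen.\<close>
  moreover have "eventually (\<lambda>v. \<bar>v 0 - u 0\<bar> < 1) (at u within K n)" by (rule close) simp
  moreover have "eventually (\<lambda>v. v \<in> K n) (at u within K n)"
    by (auto simp: eventually_at_filter)
  ultimately show ?thesis
  proof eventually_elim
    case (elim v)
    show ?case
    proof
      fix i
      show "\<bar>v i - u i\<bar> \<le> \<epsilon> * weight i"
      proof (cases "\<bar>i\<bar> \<le> int N")
        case True
        then have "i \<in> {- int N..int N}" by auto
        then have "\<bar>v i - u i\<bar> \<le> \<epsilon> * 1" using elim(1) by fastforce
        also have "\<dots> \<le> \<epsilon> * weight i" using \<open>\<epsilon> > 0\<close> by (intro mult_left_mono) auto
        finally show ?thesis .
      next
        case False
        have "\<bar>v i - u i\<bar> \<le> 1 + 2 * real n * \<bar>of_int i\<bar>"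
          using K_growth[OF u, of i] K_growth[of v n i] elim(2,3) by linarith
        also have "\<dots> = 1 + 2 * real n * real (nat \<bar>i\<bar>)" by simp
        also have "\<dots> \<le> \<epsilon> * weight i" unfolding weight_def using False by (intro N) linarith
        finally show ?thesis .
      qed
    qed
  qed
qed

section \<open>The given semiflow: equivariance, semigroup law, injectivity, continuity\<close>

locale lattice_semiflow =
  fixes V :: "real \<Rightarrow> real \<Rightarrow> real" and F :: "real \<Rightarrow> real"
    and \<phi> :: "real \<Rightarrow> (int \<Rightarrow> real) \<Rightarrow> int \<Rightarrow> real"
  assumes twist: "twist_potential V" and semiflow: "solution_semiflow V F \<phi>"
begin

lemma trajectory_phi:
  assumes "u \<in> K n"
  shows "trajectory V F n (\<lambda>t. \<phi> t u)"
proof -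
  have "u \<in> X" using assms K_subset_X by blast
  with semiflow have "\<forall>t\<ge>0. \<forall>j. ((\<lambda>s. \<phi> s u j) has_real_derivative
      lattice_field V (\<phi> t u) j + F t) (at t within {0..})" "\<forall>t\<ge>0. \<phi> t u \<in> K n"
    using assms by (simp_all add: solution_semiflow_def lattice_field_def)
  then show ?thesis by (simp add: trajectory_def)
qed

lemma phi_0 [simp]:
  assumes "u \<in> K n"
  shows "\<phi> 0 u = u"
proof -
  have "u \<in> X" using assms K_subset_X by blast
  with semiflow show ?thesis by (simp add: solution_semiflow_def)
qed

lemma phi_in_K: "u \<in> K n \<Longrightarrow> 0 \<le> t \<Longrightarrow> \<phi> t u \<in> K n"
  using trajectory_phi[of u n] by (simp add: trajectory_def)

text \<open>Uniqueness leaves one trajectory from \<open>x 0\<close>. Commutation with translation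
  and shift, and the semigroup law, are obtained by choosing \<open>x\<close>.\<close>

lemma phi_eq:
  assumes "trajectory V F n x" "0 \<le> t"
  shows "\<phi> t (x 0) = x t"
proof -
  have "x 0 \<in> K n" using assms by (simp add: trajectory_def)
  then show ?thesis
    using trajectory_unique[OF twist trajectory_phi assms(1), of "x 0" 0 t] assms(2) by simp
qed

lemma phi_translate:
  assumes "u \<in> K n" "0 \<le> t"
  shows "\<phi> t (translate k u) = translate k (\<phi> t u)"
  using phi_eq[OF trajectory_translate[OF twist trajectory_phi[OF assms(1)]] assms(2)] assms
  by simp

lemma phi_shift:
  assumes "u \<in> K n" "0 \<le> t"
  shows "\<phi> t (shift u) = shift (\<phi> t u)"
  using phi_eq[OF trajectory_shift[OF trajectory_phi[OF assms(1)]] assms(2)] assms by simp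

lemma phi_add:
  assumes "u \<in> K n" "0 \<le> s" "0 \<le> t" "\<And>t. F (s + t) = F t"
  shows "\<phi> (s + t) u = \<phi> t (\<phi> s u)"
  using phi_eq[OF trajectory_delay[OF trajectory_phi[OF assms(1)] assms(4,2)] assms(3)] by simp

text \<open>Uniqueness run backward, from time \<open>t\<close> to time 0.\<close>

lemma inj_on_phi:
  assumes "0 \<le> t"
  shows "inj_on (\<phi> t) (K n)"
proof (rule inj_onI)
  fix u v assume "u \<in> K n" "v \<in> K n" "\<phi> t u = \<phi> t v"
  then show "u = v"
    using trajectory_unique[OF twist trajectory_phi trajectory_phi, of u n v t 0] assms by simp
qed

text \<open>Two errors are separated: that of changing the initial value, controlled uniformly over
  times up to \<open>t + 1\<close>, and that of moving in time along the fixed orbit of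
  \<open>u\<close>.\<close>

lemma continuous_on_phi: "continuous_on ({0..} \<times> K n) (\<lambda>(t, u). \<phi> t u)"
proof (rule continuous_on_coordinatewise_then_product)
  fix j
  obtain h where h: "h > 0"
    "\<And>F x y s t c j k. trajectory V F n x \<Longrightarrow> trajectory V F n y \<Longrightarrow> 0 \<le> s \<Longrightarrow> 0 \<le> t \<Longrightarrow>
       \<bar>t - s\<bar> \<le> real k * h \<Longrightarrow> (\<And>i. \<bar>x s i - y s i\<bar> \<le> c * weight i) \<Longrightarrow>
       \<bar>x t j - y t j\<bar> \<le> 2 ^ k * c * weight j"
    by (rule trajectory_distance[OF twist, where n = n]) (rule that; blast)
  show "continuous_on ({0..} \<times> K n) (\<lambda>p. (case p of (t, u) \<Rightarrow> \<phi> t u) j)"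
    unfolding continuous_on_def
  proof clarsimp
    fix t :: real and u assume t: "0 \<le> t" and u: "u \<in> K n"
    define G where "G = at (t, u) within {0..} \<times> K n"
    have fst: "filterlim fst (nhds t) G" and snd: "filterlim snd (nhds u) G"
      unfolding G_def by (auto intro!: tendsto_eq_intros)
    have mem: "eventually (\<lambda>p. fst p \<in> {0..} \<and> snd p \<in> K n) G"
      unfolding G_def eventually_at_filter by (rule always_eventually) auto
    have "((\<lambda>p. \<phi> (fst p) (snd p) j) \<longlongrightarrow> \<phi> t u j) G"
    proof (rule tendstoI)
      fix e :: real assume "e > 0"
      obtain k where k: "t + 1 \<le> real k * h"
        using reals_Archimedean3[OF h(1)] by (meson less_imp_le)
      \<comment> \<open>\<open>k\<close> steps of length \<open>h\<close> cover the times up to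
        \<open>t + 1\<close>; this choice makes the amplified initial error at site \<open>j\<close>
        equal to \<open>e / 4\<close>.\<close>
      define \<epsilon> where "\<epsilon> = e / (4 * 2 ^ k * weight j)"
      have "\<epsilon> > 0" using \<open>e > 0\<close> by (simp add: \<epsilon>_def)
      \<comment> \<open>The punctured filter leaves out \<open>v = u\<close>, where the bound
        reduces to nonnegativity.\<close>
      have "0 \<le> \<epsilon> * weight i" for i
        using \<open>\<epsilon> > 0\<close> by (intro mult_nonneg_nonneg) (simp_all add: less_imp_le)
      then have "eventually (\<lambda>v. v \<in> K n \<longrightarrow> (\<forall>i. \<bar>v i - u i\<bar> \<le> \<epsilon> * weight i)) (nhds u)"
        using eventually_weighted_close[OF u \<open>\<epsilon> > 0\<close>]
        unfolding eventually_at_filter by (auto elim: eventually_mono)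
      from eventually_compose_filterlim[OF this snd]
      have 1: "eventually (\<lambda>p. snd p \<in> K n \<longrightarrow> (\<forall>i. \<bar>snd p i - u i\<bar> \<le> \<epsilon> * weight i)) G" .
      have 2: "eventually (\<lambda>p. dist (fst p) t < 1) G" using fst by (rule tendstoD) simp
      have "continuous_on {0..} (\<lambda>s. \<phi> s u j)"
        using trajectory_continuous[OF trajectory_phi[OF u]] by simp
      moreover have "eventually (\<lambda>p. fst p \<in> {0..}) G" using mem by eventually_elim auto
      ultimately have "((\<lambda>p. \<phi> (fst p) u j) \<longlongrightarrow> \<phi> t u j) G"
        using t fst by (intro continuous_on_tendsto_compose[of _ "\<lambda>s. \<phi> s u j"]) auto
      then have 3: "eventually (\<lambda>p. dist (\<phi> (fst p) u j) (\<phi> t u j) < e / 2) G"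
        using \<open>e > 0\<close> by (intro tendstoD) auto
      show "eventually (\<lambda>p. dist (\<phi> (fst p) (snd p) j) (\<phi> t u j) < e) G"
        using 1 2 3 mem
      proof eventually_elim
        case (elim p)
        have "\<bar>\<phi> (fst p) (snd p) j - \<phi> (fst p) u j\<bar> \<le> 2 ^ k * \<epsilon> * weight j"
          by (rule h(2)[OF trajectory_phi trajectory_phi, where s = 0])
            (use elim u t k in \<open>auto simp: dist_real_def\<close>)
        also have "\<dots> = e / 4" by (simp add: \<epsilon>_def less_imp_neq[OF weight_pos, symmetric])
        finally show ?case using elim(3) \<open>e > 0\<close> unfolding dist_real_def by linarith
      qed
    qed
    then show "((\<lambda>p. (case p of (t, u) \<Rightarrow> \<phi> t u) j) \<longlongrightarrow> \<phi> t u j) (at (t, u) within {0..} \<times> K n)"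
      by (simp add: G_def case_prod_beta)
  qed
qed

end

section \<open>Flows from bijective semiflows\<close>

text \<open>Identifies the continuous inverse with \<open>inv_into\<close>, the form in which
  \<open>proj_inv\<close> and the negative times of \<open>phi_attractor\<close> are
  defined.\<close>

lemma homeomorphic_maps_inv_into:
  assumes "homeomorphic_map S T f"
  shows "homeomorphic_maps S T f (inv_into (topspace S) f)"
proof -
  obtain g where g: "homeomorphic_maps S T f g" using assms homeomorphic_map_maps by blast
  have "inv_into (topspace S) f y = g y" if "y \<in> topspace T" for y
  proof (rule inv_into_f_eq)
    show "inj_on f (topspace S)" using assms by (rule homeomorphic_imp_injective_map)
    show "g y \<in> topspace S" "f (g y) = y"
      using g that continuous_map_image_subset_topspace[of T S g]
      by (auto simp: homeomorphic_maps_def)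
  qed
  then show ?thesis by (intro homeomorphic_maps_eq[OF g]) auto
qed

text \<open>For \<open>t \<ge> - N\<close> the flow is \<open>\<Phi>\<^sub>t = \<phi>\<^sub>t\<^sub>+\<^sub>N \<circ> (\<phi>\<^sub>N)\<inverse>\<close>, and \<open>(\<phi>\<^sub>N)\<inverse>\<close> is continuous by compactness.\<close>

lemma continuous_flow_of_bij_semiflow:
  assumes S: "compact_space S" "Hausdorff_space S"
    and cont: "continuous_map (prod_topology (top_of_set {0..}) S) S (\<lambda>(t, x). \<phi> t x)"
    and \<phi>0: "\<And>x. x \<in> topspace S \<Longrightarrow> \<phi> 0 x = x"
    and add: "\<And>s t x. 0 \<le> s \<Longrightarrow> 0 \<le> t \<Longrightarrow> x \<in> topspace S \<Longrightarrow> \<phi> (s + t) x = \<phi> t (\<phi> s x)"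
    and bij: "\<And>t. 0 \<le> t \<Longrightarrow> bij_betw (\<phi> t) (topspace S) (topspace S)"
  shows "continuous_flow S (\<lambda>t. if 0 \<le> t then \<phi> t else inv_into (topspace S) (\<phi> (- t)))"
proof -
  define \<Phi> where "\<Phi> t = (if 0 \<le> t then \<phi> t else inv_into (topspace S) (\<phi> (- t)))" for t
  define \<psi> where "\<psi> t = inv_into (topspace S) (\<phi> t)" for t
  have in_S: "\<phi> t x \<in> topspace S" if "0 \<le> t" "x \<in> topspace S" for t x
    using bij[OF that(1)] that(2) by (rule bij_betwE[rule_format])
  have \<psi>: "\<psi> t x \<in> topspace S" "\<phi> t (\<psi> t x) = x" if "0 \<le> t" "x \<in> topspace S" for t x
    using bij[OF that(1)] that(2) unfolding \<psi>_def bij_betw_def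
    by (metis inv_into_into, metis f_inv_into_f)
  have \<psi>_\<phi>: "\<psi> t (\<phi> t x) = x" if "0 \<le> t" "x \<in> topspace S" for t x
    using bij[OF that(1)] that(2) unfolding \<psi>_def bij_betw_def by (metis inv_into_f_f)
  \<comment> \<open>At points written as \<open>\<phi> N y\<close>, applying \<open>\<Phi> t\<close>
    amounts to adding times, also for negative \<open>t\<close> as long as the sum stays
    nonnegative.\<close>
  have \<Phi>_\<phi>: "\<Phi> t (\<phi> N y) = \<phi> (t + N) y" if "0 \<le> N" "0 \<le> t + N" "y \<in> topspace S" for t N y
  proof (cases "0 \<le> t")
    case True
    then show ?thesis using add[of N t y] that by (simp add: \<Phi>_def add.commute)
  next
    case False
    then have "\<phi> N y = \<phi> (- t) (\<phi> (t + N) y)" using add[of "t + N" "- t" y] that by simp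
    then show ?thesis using False \<psi>_\<phi>[of "- t" "\<phi> (t + N) y"] that in_S by (simp add: \<Phi>_def \<psi>_def)
  qed
  have flow: "\<Phi> (s + t) x = \<Phi> s (\<Phi> t x)" if x: "x \<in> topspace S" for s t x
  proof -
    \<comment> \<open>Large enough for \<open>t + N\<close> and \<open>s + t + N\<close> to be
      nonnegative, so the group law becomes associativity of addition.\<close>
    define N where "N = \<bar>s\<bar> + \<bar>t\<bar>"
    define y where "y = \<psi> N x"
    have N: "0 \<le> N" "0 \<le> t + N" "0 \<le> s + t + N" "0 \<le> s + (t + N)" by (auto simp: N_def)
    have y: "y \<in> topspace S" "\<phi> N y = x" unfolding y_def using N(1) x \<psi> by auto
    have "\<Phi> (s + t) x = \<phi> (s + t + N) y" using \<Phi>_\<phi>[OF N(1,3) y(1)] y(2) by simp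
    also have "\<dots> = \<Phi> s (\<phi> (t + N) y)" using \<Phi>_\<phi>[OF N(2,4) y(1)] by (simp add: add.assoc)
    also have "\<phi> (t + N) y = \<Phi> t x" using \<Phi>_\<phi>[OF N(1,2) y(1)] y(2) by simp
    finally show ?thesis .
  qed
  have cont_\<psi>: "continuous_map S S (\<psi> t)" if "0 \<le> t" for t
  proof -
    have "continuous_map S (prod_topology (top_of_set {0..}) S) (\<lambda>x. (t, x))"
      using that by (simp add: continuous_map_pairwise o_def)
    from continuous_map_compose[OF this cont] have "continuous_map S S (\<phi> t)" by (simp add: o_def)
    then have "homeomorphic_map S S (\<phi> t)"
      using S bij[OF that] by (intro continuous_imp_homeomorphic_map) (auto simp: bij_betw_def)
    then show ?thesis unfolding \<psi>_def
      using homeomorphic_maps_inv_into homeomorphic_maps_def by blast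
  qed
  have "continuous_map (prod_topology euclideanreal S) S (\<lambda>(t, x). \<Phi> t x)"
  proof (rule pasting_lemma[where I = "UNIV :: nat set" and T = "\<lambda>N. {- real N<..} \<times> topspace S"
        and f = "\<lambda>N (t, x). \<phi> (t + real N) (\<psi> (real N) x)"])
    show "openin (prod_topology euclideanreal S) ({- real N<..} \<times> topspace S)" for N
      by (simp add: openin_prod_Times_iff)
    show "continuous_map (subtopology (prod_topology euclideanreal S) ({- real N<..} \<times> topspace S)) S
        (\<lambda>(t, x). \<phi> (t + real N) (\<psi> (real N) x))" (is "continuous_map ?Z S _") for N
    proof -
      have fst: "continuous_map ?Z euclideanreal fst" and snd: "continuous_map ?Z S snd"
        by (auto intro: continuous_map_from_subtopology continuous_map_fst continuous_map_snd)
      have "continuous_map ?Z euclideanreal (\<lambda>p. fst p + real N)"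
        by (intro continuous_map_add fst) simp
      then have "continuous_map ?Z (top_of_set {0..}) (\<lambda>p. fst p + real N)"
        by (auto simp: continuous_map_in_subtopology)
      moreover have "continuous_map ?Z S (\<lambda>p. \<psi> (real N) (snd p))"
        using continuous_map_compose[OF snd cont_\<psi>[of "real N"]] by (simp add: o_def)
      ultimately have "continuous_map ?Z (prod_topology (top_of_set {0..}) S)
          (\<lambda>p. (fst p + real N, \<psi> (real N) (snd p)))"
        by (simp add: continuous_map_pairwise o_def)
      from continuous_map_compose[OF this cont] show ?thesis by (simp add: o_def case_prod_unfold)
    qed
    \<comment> \<open>Every local formula computes the same \<open>\<Phi>\<close>, hence they agree
      on overlaps and can be pasted.\<close>
    have eq: "\<Phi> t x = \<phi> (t + real N) (\<psi> (real N) x)" if "- real N < t" "x \<in> topspace S" for t x N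
      using \<Phi>_\<phi>[of "real N" t "\<psi> (real N) x"] \<psi>[of "real N" x] that by simp
    show "(case p of (t, x) \<Rightarrow> \<phi> (t + real M) (\<psi> (real M) x))
        = (case p of (t, x) \<Rightarrow> \<phi> (t + real N) (\<psi> (real N) x))"
      if "p \<in> topspace (prod_topology euclideanreal S) \<inter> {- real M<..} \<times> topspace S
        \<inter> {- real N<..} \<times> topspace S" for M N p
      using that by (auto simp flip: eq)
    show "\<exists>N. N \<in> UNIV \<and> p \<in> {- real N<..} \<times> topspace S \<and>
        (case p of (t, x) \<Rightarrow> \<Phi> t x) = (case p of (t, x) \<Rightarrow> \<phi> (t + real N) (\<psi> (real N) x))"
      if p_in: "p \<in> topspace (prod_topology euclideanreal S)" for p
    proof -
      obtain t x where p: "p = (t, x)" "x \<in> topspace S" using p_in by (cases p) auto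
      obtain N where "- t < real N" using reals_Archimedean2 by blast
      then have "- real N < t" by simp
      then show ?thesis using p eq by (intro exI[of _ N]) simp
    qed
  qed
  moreover have "\<Phi> 0 x = x" if "x \<in> topspace S" for x using \<phi>0 that by (simp add: \<Phi>_def)
  ultimately have "continuous_flow S \<Phi>" using flow by (simp add: continuous_flow_def)
  then show ?thesis by (simp add: \<Phi>_def[abs_def])
qed

lemma homeomorphic_map_conjugate:
  assumes fg: "homeomorphic_maps S T f g" and h: "homeomorphic_map S S h"
  shows "homeomorphic_map T T (f \<circ> h \<circ> g)"
proof -
  have "homeomorphic_map S T f" and g: "homeomorphic_map T S g"
    using fg by (simp_all add: homeomorphic_maps_map)
  then have "homeomorphic_map S T (f \<circ> h)" by (intro homeomorphic_map_compose[OF h])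
  with g show ?thesis by (rule homeomorphic_map_compose)
qed

lemma continuous_flow_conjugate:
  assumes fg: "homeomorphic_maps S T f g" and \<Phi>: "continuous_flow S \<Phi>"
  shows "continuous_flow T (\<lambda>t. f \<circ> \<Phi> t \<circ> g)"
proof -
  have f: "continuous_map S T f" and g: "continuous_map T S g"
    and gf: "\<And>x. x \<in> topspace S \<Longrightarrow> g (f x) = x" and fg': "\<And>y. y \<in> topspace T \<Longrightarrow> f (g y) = y"
    using fg by (auto simp: homeomorphic_maps_def)
  have cont: "continuous_map (prod_topology euclideanreal S) S (\<lambda>(t, x). \<Phi> t x)"
    and \<Phi>0: "\<And>x. x \<in> topspace S \<Longrightarrow> \<Phi> 0 x = x"
    and add: "\<And>s t x. x \<in> topspace S \<Longrightarrow> \<Phi> (s + t) x = \<Phi> s (\<Phi> t x)"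
    using \<Phi> by (auto simp: continuous_flow_def)
  have g_in: "g y \<in> topspace S" if "y \<in> topspace T" for y
    using g that by (auto simp: continuous_map_def)
  have \<Phi>_in: "\<Phi> t x \<in> topspace S" if "x \<in> topspace S" for t x
    using funcset_mem[OF continuous_map_funspace[OF cont], of "(t, x)"] that by simp
  have "continuous_map (prod_topology euclideanreal T) (prod_topology euclideanreal S)
      (\<lambda>p. (fst p, g (snd p)))"
    using continuous_map_compose[OF continuous_map_snd g]
    by (simp add: continuous_map_pairwise o_def continuous_map_fst)
  from continuous_map_compose[OF continuous_map_compose[OF this cont] f]
  have "continuous_map (prod_topology euclideanreal T) T (\<lambda>(t, y). f (\<Phi> t (g y)))"
    by (simp add: o_def case_prod_unfold)
  then show ?thesis
    unfolding continuous_flow_def using \<Phi>0 add gf fg' g_in \<Phi>_in by (simp add: o_def)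
qed

section \<open>Dynamics on the attractor\<close>

definition attractor_top ::
  "driving \<Rightarrow> (real \<Rightarrow> (int \<Rightarrow> real) \<Rightarrow> int \<Rightarrow> real) \<Rightarrow> nat \<Rightarrow> (int \<Rightarrow> real) set topology" where
  "attractor_top d \<phi> n = subtopology (KQ n) (attractor d \<phi> n)"

lemma topspace_attractor_top [simp]: "topspace (attractor_top d \<phi> n) = attractor d \<phi> n"
  using attractor_subset[of d \<phi> n] by (simp add: attractor_top_def inf_absorb2)

lemma compact_space_attractor_top: "compact_space (attractor_top d \<phi> n)"
  unfolding attractor_top_def
  by (intro compact_space_subtopology closedin_compact_space compact_space_KQ
      closedin_attractor second_countable_KQ)

lemma Hausdorff_attractor_top: "Hausdorff_space (attractor_top d \<phi> n)"
  unfolding attractor_top_def by (intro Hausdorff_space_subtopology Hausdorff_KQ)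

lemma image_attractor:
  assumes f: "continuous_map (KQ n) (KQ n) f"
    and pres: "\<And>\<mu>. \<mu> \<in> invariant_measures d \<phi> n \<Longrightarrow> preserved_by \<mu> f"
  shows "f ` attractor d \<phi> n = attractor d \<phi> n"
proof -
  have "f ` supp (KQ n) \<mu> = supp (KQ n) \<mu>" if "\<mu> \<in> invariant_measures d \<phi> n" for \<mu>
    using that by (intro image_supp compact_space_KQ Hausdorff_KQ second_countable_KQ f pres
        invariant_measures_sets)
  then show ?thesis by (simp add: attractor_def image_UN)
qed

text \<open>Injectivity is inherited from the whole space; surjectivity belongs to the attractor and
  comes from the measures. Compactness makes the inverse continuous.\<close>

lemma homeomorphic_map_attractor:
  assumes f: "continuous_map (KQ n) (KQ n) f"
    and pres: "\<And>\<mu>. \<mu> \<in> invariant_measures d \<phi> n \<Longrightarrow> preserved_by \<mu> f"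
    and inj: "inj_on f (topspace (KQ n))"
  shows "homeomorphic_map (attractor_top d \<phi> n) (attractor_top d \<phi> n) f"
proof (rule continuous_imp_homeomorphic_map)
  have im: "f ` attractor d \<phi> n = attractor d \<phi> n" using f pres by (rule image_attractor)
  then show "f ` topspace (attractor_top d \<phi> n) = topspace (attractor_top d \<phi> n)" by simp
  show "continuous_map (attractor_top d \<phi> n) (attractor_top d \<phi> n) f"
    using im attractor_subset[of d \<phi> n] unfolding attractor_top_def
    by (auto simp: continuous_map_in_subtopology intro: continuous_map_from_subtopology[OF f])
  show "inj_on f (topspace (attractor_top d \<phi> n))"
    using inj_on_subset[OF inj attractor_subset] by simp
qed (fact compact_space_attractor_top Hausdorff_attractor_top)+

lemma topspace_K_tilde: "topspace (K_tilde d \<phi> n) = proj ` attractor d \<phi> n"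
proof -
  have "proj ` attractor d \<phi> n \<subseteq> topspace (prod_topology circle euclideanreal)"
    using continuous_map_image_subset_topspace[OF continuous_map_proj[of n]] attractor_subset[of d \<phi> n]
    by blast
  then show ?thesis by (auto simp: K_tilde_def)
qed

lemma homeomorphic_maps_proj:
  assumes "inj_on proj (attractor d \<phi> n)"
  shows "homeomorphic_maps (attractor_top d \<phi> n) (K_tilde d \<phi> n) proj (proj_inv d \<phi> n)"
proof -
  have "homeomorphic_map (attractor_top d \<phi> n) (K_tilde d \<phi> n) proj"
  proof (rule continuous_imp_homeomorphic_map)
    show "continuous_map (attractor_top d \<phi> n) (K_tilde d \<phi> n) proj"
      unfolding K_tilde_def attractor_top_def
      by (auto simp: continuous_map_in_subtopology
          intro: continuous_map_from_subtopology[OF continuous_map_proj])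
    show "Hausdorff_space (K_tilde d \<phi> n)"
      unfolding K_tilde_def
      by (intro Hausdorff_space_subtopology) (simp add: Hausdorff_space_prod_topology Hausdorff_circle)
  qed (use assms in \<open>simp_all add: compact_space_attractor_top topspace_K_tilde\<close>)
  then show ?thesis
    using homeomorphic_maps_inv_into by (fastforce simp: proj_inv_def)
qed

lemma continuous_map_shift: "continuous_map (KQ n) (KQ n) ((`) shift)"
proof (rule continuous_compose_quotient_map[OF quotient_map_config_class])
  have "continuous_on (K n) shift"
    unfolding shift_def
    by (intro continuous_on_coordinatewise_then_product
        continuous_on_product_then_coordinatewise[OF continuous_on_id])
  then have "continuous_map (top_of_set (K n)) (top_of_set (K n)) shift"
    by (auto simp: continuous_map_in_subtopology)
  then have "continuous_map (top_of_set (K n)) (KQ n) (config_class \<circ> shift)"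
    using quotient_imp_continuous_map[OF quotient_map_config_class] by (rule continuous_map_compose)
  then show "continuous_map (top_of_set (K n)) (KQ n) ((`) shift \<circ> config_class)"
    by (simp add: o_def image_config_class shift_translate)
qed

lemma inj_image_shift: "inj_on ((`) shift) A"
  using inj_shift by (auto simp: inj_on_def inj_image_eq_iff)

context lattice_semiflow
begin

lemma phi_config_class:
  assumes "u \<in> K n" "0 \<le> t"
  shows "\<phi> t ` config_class u = config_class (\<phi> t u)"
  using assms by (intro image_config_class phi_translate)

lemma continuous_map_phi_KQ:
  "continuous_map (prod_topology (top_of_set {0..}) (KQ n)) (KQ n) (\<lambda>(t, C). \<phi> t ` C)"
proof (rule continuous_compose_quotient_map[OF quotient_map_prod_config_class])
  have "continuous_map (top_of_set ({0..} \<times> K n)) (top_of_set (K n)) (\<lambda>(t, u). \<phi> t u)"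
    using continuous_on_phi[of n] by (auto simp: continuous_map_in_subtopology phi_in_K)
  then have "continuous_map (top_of_set ({0..} \<times> K n)) (KQ n) (config_class \<circ> (\<lambda>(t, u). \<phi> t u))"
    using quotient_imp_continuous_map[OF quotient_map_config_class] by (rule continuous_map_compose)
  then have "continuous_map (top_of_set ({0..} \<times> K n)) (KQ n)
      ((\<lambda>(t, C). \<phi> t ` C) \<circ> (\<lambda>(t, u). (t, config_class u)))"
    by (rule continuous_map_eq) (clarsimp simp: phi_config_class)
  then show "continuous_map (prod_topology (top_of_set {0..}) (top_of_set (K n))) (KQ n)
      ((\<lambda>(t, C). \<phi> t ` C) \<circ> (\<lambda>(t, u). (t, config_class u)))"
    by simp
qed

lemma continuous_map_phi_time:
  assumes "0 \<le> t"
  shows "continuous_map (KQ n) (KQ n) ((`) (\<phi> t))"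
proof -
  have "continuous_map (KQ n) (prod_topology (top_of_set {0..}) (KQ n)) (\<lambda>C. (t, C))"
    using assms by (simp add: continuous_map_pairwise o_def)
  from continuous_map_compose[OF this continuous_map_phi_KQ] show ?thesis by (simp add: o_def)
qed

text \<open>If two images differ by a translate, equivariance moves the translate to the initial
  value, where injectivity on \<open>K n\<close> applies.\<close>

lemma inj_on_phi_KQ:
  assumes "0 \<le> t"
  shows "inj_on ((`) (\<phi> t)) (topspace (KQ n))"
proof (rule inj_onI)
  fix C D assume "C \<in> topspace (KQ n)" "D \<in> topspace (KQ n)" and eq: "\<phi> t ` C = \<phi> t ` D"
  then obtain u v where u: "u \<in> K n" "C = config_class u" and v: "v \<in> K n" "D = config_class v"
    by (auto simp: topspace_KQ)
  from eq u v obtain k where "\<phi> t v = translate k (\<phi> t u)"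
    using assms by (auto simp: phi_config_class config_class_eq_iff)
  then have "\<phi> t v = \<phi> t (translate k u)" using u assms by (simp add: phi_translate)
  then have "v = translate k u" using inj_on_phi[OF assms, of n] u v by (auto dest: inj_onD)
  then show "C = D" using u v by (auto simp: config_class_eq_iff)
qed

lemma phi_shift_KQ:
  assumes "C \<in> topspace (KQ n)" "0 \<le> t"
  shows "shift ` \<phi> t ` C = \<phi> t ` shift ` C"
proof -
  obtain u where "u \<in> K n" "C = config_class u" using assms(1) by (auto simp: topspace_KQ)
  then show ?thesis
    using assms(2) by (simp add: phi_config_class image_config_class shift_translate phi_shift)
qed

end

theorem theorem2:
  fixes d :: driving
    and V :: "real \<Rightarrow> real \<Rightarrow> real"
    and F :: "real \<Rightarrow> real"
    and \<phi> :: "real \<Rightarrow> (int \<Rightarrow> real) \<Rightarrow> int \<Rightarrow> real"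
    and n :: nat
  assumes "twist_potential V"
    and "admissible_driving d V F"
    and "solution_semiflow V F \<phi>"
    and "inj_on proj (\<Union>m. attractor d \<phi> m)"
  shows "homeomorphic_map (K_tilde d \<phi> n) (K_tilde d \<phi> n) (T_tilde d \<phi> n) \<and>
     (d = DC \<longrightarrow>
        (\<forall>t\<ge>0. bij_betw ((`) (\<phi> t)) (attractor d \<phi> n) (attractor d \<phi> n)) \<and>
        continuous_flow (K_tilde d \<phi> n) (phi_tilde d \<phi> n) \<and>
        (\<forall>t. \<forall>x\<in>topspace (K_tilde d \<phi> n).
           T_tilde d \<phi> n (phi_tilde d \<phi> n t x) = phi_tilde d \<phi> n t (T_tilde d \<phi> n x))) \<and>
     (d = AC \<longrightarrow>
        homeomorphic_map (K_tilde d \<phi> n) (K_tilde d \<phi> n) (phi_tilde d \<phi> n 1) \<and>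
        (\<forall>x\<in>topspace (K_tilde d \<phi> n).
           T_tilde d \<phi> n (phi_tilde d \<phi> n 1 x) = phi_tilde d \<phi> n 1 (T_tilde d \<phi> n x)))"
proof -
  interpret lattice_semiflow V F \<phi> using assms(1,3) by unfold_locales
  define A where "A = attractor d \<phi> n"
  let ?S = "attractor_top d \<phi> n" and ?\<Phi> = "phi_attractor d \<phi> n"
  have A_sub: "A \<subseteq> topspace (KQ n)" unfolding A_def by (rule attractor_subset)
  have inj: "inj_on proj A" using assms(4) unfolding A_def by (rule inj_on_subset) auto
  then have conj: "homeomorphic_maps ?S (K_tilde d \<phi> n) proj (proj_inv d \<phi> n)"
    unfolding A_def by (rule homeomorphic_maps_proj)
  have proj_inv: "proj_inv d \<phi> n (proj C) = C" if "C \<in> A" for C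
    using inj that by (simp add: proj_inv_def A_def)
  have shift_hom: "homeomorphic_map ?S ?S ((`) shift)"
    by (rule homeomorphic_map_attractor[OF continuous_map_shift _ inj_image_shift])
      (simp add: invariant_measures_def)
  have shift_A: "shift ` C \<in> A" if "C \<in> A" for C
    using homeomorphic_imp_surjective_map[OF shift_hom] that by (auto simp: A_def)
  \<comment> \<open>Invariance of the measures is available at \<open>times d\<close>: every
    \<open>t \<ge> 0\<close> for constant forcing, \<open>t = 1\<close> for periodic
    forcing.\<close>
  have phi_hom: "homeomorphic_map ?S ?S ((`) (\<phi> t))" if "t \<in> times d" "0 \<le> t" for t
    by (rule homeomorphic_map_attractor[OF continuous_map_phi_time _ inj_on_phi_KQ])
      (use that in \<open>auto simp: invariant_measures_def\<close>)
  have bij: "bij_betw ((`) (\<phi> t)) A A" if "t \<in> times d" "0 \<le> t" for t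
    using phi_hom[OF that]
    by (simp add: A_def bij_betw_def homeomorphic_eq_everything_map)
  have phi_A: "\<phi> t ` C \<in> A" if "t \<in> times d" "0 \<le> t" "C \<in> A" for t C
    using bij_betwE[OF bij[OF that(1,2)]] that(3) by blast
  \<comment> \<open>The absolute value admits negative times, where \<open>phi_attractor\<close> is
    an inverse; it is evaluated by writing \<open>C\<close> as the image of some \<open>D\<close> in
    \<open>A\<close>.\<close>
  have commute: "?\<Phi> t C \<in> A \<and> shift ` ?\<Phi> t C = ?\<Phi> t (shift ` C)"
    if t_abs: "\<bar>t\<bar> \<in> times d" and C: "C \<in> A" for t C
  proof (cases "0 \<le> t")
    case True
    then show ?thesis
      using t_abs C phi_A phi_shift_KQ[of C n t] A_sub by (simp add: phi_attractor_def subset_iff)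
  next
    case False
    then have t: "- t \<in> times d" "0 \<le> - t" using t_abs by auto
    then obtain D where D: "D \<in> A" "C = \<phi> (- t) ` D"
      using bij[OF t] C unfolding bij_betw_def by blast
    have inj: "inj_on ((`) (\<phi> (- t))) A" using bij[OF t] by (simp add: bij_betw_def)
    have "shift ` C = \<phi> (- t) ` shift ` D" using phi_shift_KQ[of D n "- t"] D A_sub t(2) by auto
    then show ?thesis
      using False D shift_A[OF D(1)] inv_into_f_f[OF inj] by (simp add: phi_attractor_def A_def)
  qed
  have T_phi: "T_tilde d \<phi> n (phi_tilde d \<phi> n t x) = phi_tilde d \<phi> n t (T_tilde d \<phi> n x)"
    if t: "\<bar>t\<bar> \<in> times d" and x: "x \<in> topspace (K_tilde d \<phi> n)" for t x
  proof -
    obtain C where C: "C \<in> A" "x = proj C" using x by (auto simp: topspace_K_tilde A_def)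
    show ?thesis
      using commute[OF t C(1)] C shift_A by (simp add: T_tilde_def phi_tilde_def proj_inv)
  qed
  have "homeomorphic_map (K_tilde d \<phi> n) (K_tilde d \<phi> n) (T_tilde d \<phi> n)"
    unfolding T_tilde_def using conj shift_hom by (rule homeomorphic_map_conjugate)
  moreover have "continuous_flow (K_tilde d \<phi> n) (phi_tilde d \<phi> n)" if d: "d = DC"
  proof -
    \<comment> \<open>Constant forcing has every number as a period, as \<open>phi_add\<close>
      asks.\<close>
    from assms(2) d obtain c where F: "\<And>t. F t = c" by auto
    have "continuous_flow ?S (\<lambda>t. if 0 \<le> t then (`) (\<phi> t) else inv_into (topspace ?S) ((`) (\<phi> (- t))))"
    proof (rule continuous_flow_of_bij_semiflow)
      show "continuous_map (prod_topology (top_of_set {0..}) ?S) ?S (\<lambda>(t, C). \<phi> t ` C)"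
      proof -
        have "continuous_map (prod_topology (top_of_set {0..}) ?S) (KQ n) (\<lambda>(t, C). \<phi> t ` C)"
          unfolding attractor_top_def prod_topology_subtopology(2)
          by (rule continuous_map_from_subtopology[OF continuous_map_phi_KQ])
        then show ?thesis
          using phi_A d unfolding attractor_top_def[of d]
          by (auto simp: continuous_map_in_subtopology A_def)
      qed
      have repr: "\<exists>u\<in>K n. C = config_class u" if "C \<in> topspace ?S" for C
        using that A_sub unfolding A_def topspace_KQ by auto
      show "\<phi> 0 ` C = C" if "C \<in> topspace ?S" for C
      proof -
        from repr[OF that] obtain u where "u \<in> K n" "C = config_class u" by blast
        then show ?thesis by (simp add: phi_config_class)
      qed
      show "\<phi> (s + t) ` C = \<phi> t ` \<phi> s ` C" if "0 \<le> s" "0 \<le> t" "C \<in> topspace ?S" for s t C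
      proof -
        from repr[OF that(3)] obtain u where u: "u \<in> K n" "C = config_class u" by blast
        have "\<phi> (s + t) u = \<phi> t (\<phi> s u)" using u(1) that(1,2) F by (intro phi_add) auto
        then show ?thesis
          using u that(1,2) phi_in_K[OF u(1) that(1)] by (simp add: phi_config_class)
      qed
    qed (use bij d in \<open>auto simp: A_def compact_space_attractor_top Hausdorff_attractor_top\<close>)
    then have "continuous_flow ?S ?\<Phi>" by (simp add: phi_attractor_def[abs_def] cong: if_cong)
    with conj have "continuous_flow (K_tilde d \<phi> n) (\<lambda>t. proj \<circ> ?\<Phi> t \<circ> proj_inv d \<phi> n)"
      by (rule continuous_flow_conjugate)
    then show ?thesis by (simp add: phi_tilde_def[abs_def])
  qed
  moreover have "homeomorphic_map (K_tilde d \<phi> n) (K_tilde d \<phi> n) (phi_tilde d \<phi> n 1)" if "d = AC"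
    using homeomorphic_map_conjugate[OF conj phi_hom[of 1]] that
    by (simp add: phi_tilde_def phi_attractor_def)
  ultimately show ?thesis using bij T_phi by (auto simp: A_def)
qed

end
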